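(* Let $p$ be a prime and let $G$ be a finite group weakly tame at $p$. Then: (a) $\operatorname{ed}_{\mathbb{Q}} G \geq \operatorname{ed}_{\mathbb{F}_p} G$. (b) If $K$ is a field of characteristic $0$ and $k$ is a field of characteristic $p$ containing $\overline{\mathbb{F}}_p$, then $\operatorname{ed}_K G \geq \operatorname{ed}_k G$.
   Context: A finite group $G$ is weakly tame at a prime $p$ if $G$ contains no non-trivial normal $p$-subgroup. $\overline{\mathbb{F}}_p$ denotes an algebraic closure of the field $\mathbb{F}_p$ with $p$ elements. For a field $F$ and a finite group $G$, $\operatorname{ed}_F(G) = \operatorname{ed}_F G$ denotes the essential dimension of $G$ over $F$: it is the supremum, over all field extensions $M/F$ and all $G$-torsors $T \to \operatorname{Spec} M$, of the minimum of $\operatorname{trdeg}_F M_0$ over intermediate fields $F \subseteq M_0 \subseteq M$ such that $T$ is isomorphic to the pullback of a $G$-torsor over $\operatorname{Spec} M_0$. Equivalently, if $V$ is the regular representation of $G$ over $F$, then $\operatorname{ed}_F(G)$ is the minimal value of $\operatorname{trdeg}_F(L)$ as $L$ ranges over the $G$-invariant intermediate fields $F \subseteq L \subseteq F(V)$ on which $G$ acts faithfully. *)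

theory Defs
  imports "HOL-Algebra.Algebra" "HOL-Algebra.Algebraic_Closure_Type"
    "HOL-Library.Poly_Mapping" "HOL-Library.Extended_Nat"
begin

section \<open>Polynomials and rational functions in variables indexed by an arbitrary type\<close>

text \<open>
  \<^typ>\<open>('x \<Rightarrow>\<^sub>0 nat) \<Rightarrow>\<^sub>0 'a\<close> is the polynomial ring over \<open>'a\<close> in variables
  indexed by \<open>'x\<close>. The library proves that it is an integral domain only for a linearly
  ordered index type. The wrapper type below equips a copy of an arbitrary type with an
  arbitrarily chosen linear order for this purpose only; nothing else depends on the choice.
\<close>

datatype 'g var = Var (index: 'g)

instantiation var :: (type) linorder
begin

definition less_eq_var :: "'a var \<Rightarrow> 'a var \<Rightarrow> bool" where
  "(x :: 'a var) \<le> y \<longleftrightarrow> (x, y) \<in> (SOME r. well_order_on UNIV r)"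

definition less_var :: "'a var \<Rightarrow> 'a var \<Rightarrow> bool" where
  "(x :: 'a var) < y \<longleftrightarrow> x \<le> y \<and> \<not> y \<le> x"

instance
proof
  define r :: "'a var rel" where "r = (SOME r. well_order_on UNIV r)"
  have "well_order_on UNIV r"
    unfolding r_def by (rule someI_ex) (rule well_order_on)
  then have "refl r" "trans r" "antisym r" "total r"
    by (auto simp: well_order_on_def linear_order_on_def partial_order_on_def preorder_on_def)
  moreover have le: "x \<le> y \<longleftrightarrow> (x, y) \<in> r" for x y
    by (simp add: less_eq_var_def r_def)
  ultimately show "x \<le> x" "x \<le> y \<Longrightarrow> y \<le> z \<Longrightarrow> x \<le> z" "x \<le> y \<Longrightarrow> y \<le> x \<Longrightarrow> x = y" "x \<le> y \<or> y \<le> x"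
    for x y z :: "'a var"
    by (auto simp: refl_on_def dest: transD antisymD) (metis UNIV_I refl_onD total_on_def)
qed (simp add: less_var_def)

end

type_synonym ('x, 'a) mpoly = "('x \<Rightarrow>\<^sub>0 nat) \<Rightarrow>\<^sub>0 'a"

type_synonym ('g, 'a) ratfun = "('g var, 'a) mpoly fract"

definition mpoly_const :: "'a \<Rightarrow> ('x, 'a::comm_semiring_1) mpoly" where
  "mpoly_const c = Poly_Mapping.single 0 c"

definition mpoly_var :: "'x \<Rightarrow> ('x, 'a::comm_semiring_1) mpoly" where
  "mpoly_var x = Poly_Mapping.single (Poly_Mapping.single x 1) 1"

definition mpoly_eval :: "('a \<Rightarrow> 'b) \<Rightarrow> ('x \<Rightarrow> 'b) \<Rightarrow> ('x, 'a::comm_semiring_1) mpoly \<Rightarrow> 'b::comm_semiring_1"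
  where "mpoly_eval \<phi> v P = (\<Sum>m\<in>Poly_Mapping.keys P.
    \<phi> (Poly_Mapping.lookup P m) * (\<Prod>x\<in>Poly_Mapping.keys m. v x ^ Poly_Mapping.lookup m x))"

definition mpoly_vars :: "('x, 'a::comm_semiring_1) mpoly \<Rightarrow> 'x set" where
  "mpoly_vars P = (\<Union>m\<in>Poly_Mapping.keys P. Poly_Mapping.keys m)"

definition mpoly_rename :: "('x \<Rightarrow> 'y) \<Rightarrow> ('x, 'a::comm_semiring_1) mpoly \<Rightarrow> ('y, 'a) mpoly" where
  "mpoly_rename f = mpoly_eval mpoly_const (\<lambda>x. mpoly_var (f x))"

lemma mpoly_induct [case_names zero single add]:
  assumes "Q 0" "\<And>m c. Q (Poly_Mapping.single m c)" "\<And>P P'. Q P \<Longrightarrow> Q P' \<Longrightarrow> Q (P + P')"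
  shows "Q (P :: 'm \<Rightarrow>\<^sub>0 'a::comm_monoid_add)"
proof (induction P rule: update_induct)
  case (update P m c)
  have "Poly_Mapping.update m c P = Poly_Mapping.single m c + P"
    using update.hyps
    by (intro poly_mapping_eqI)
       (auto simp: lookup_update lookup_add lookup_single in_keys_iff when_def)
  then show ?case
    using assms update.IH by metis
qed (use assms in auto)

lemma mon_eval_superset:
  assumes "finite A" "Poly_Mapping.keys m \<subseteq> A"
  shows "(\<Prod>x\<in>Poly_Mapping.keys m. v x ^ Poly_Mapping.lookup m x)
    = (\<Prod>x\<in>A. (v x :: 'b::comm_semiring_1) ^ Poly_Mapping.lookup m x)"
  by (rule prod.mono_neutral_left) (use assms in \<open>auto simp: in_keys_iff\<close>)

lemma mon_eval_add:
  "(\<Prod>x\<in>Poly_Mapping.keys (m + n). v x ^ Poly_Mapping.lookup (m + n) x)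
    = (\<Prod>x\<in>Poly_Mapping.keys m. (v x :: 'b::comm_semiring_1) ^ Poly_Mapping.lookup m x)
    * (\<Prod>x\<in>Poly_Mapping.keys n. v x ^ Poly_Mapping.lookup n x)"
proof -
  let ?A = "Poly_Mapping.keys m \<union> Poly_Mapping.keys n"
  have eq: "(\<Prod>x\<in>Poly_Mapping.keys k. v x ^ Poly_Mapping.lookup k x)
      = (\<Prod>x\<in>?A. v x ^ Poly_Mapping.lookup k x)" if "k \<in> {m, n, m + n}" for k
    using that keys_add[of m n] by (intro mon_eval_superset) auto
  have "(\<Prod>x\<in>?A. v x ^ Poly_Mapping.lookup (m + n) x)
      = (\<Prod>x\<in>?A. v x ^ Poly_Mapping.lookup m x) * (\<Prod>x\<in>?A. v x ^ Poly_Mapping.lookup n x)"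
    by (simp add: lookup_add power_add prod.distrib)
  then show ?thesis
    using eq[of m] eq[of n] eq[of "m + n"] by simp
qed

locale mpoly_eval_hom =
  fixes \<phi> :: "'a::comm_semiring_1 \<Rightarrow> 'b::comm_semiring_1"
  assumes zero: "\<phi> 0 = 0" and one: "\<phi> 1 = 1"
    and add: "\<phi> (a + b) = \<phi> a + \<phi> b" and mult: "\<phi> (a * b) = \<phi> a * \<phi> b"
begin

lemma eval_zero: "mpoly_eval \<phi> v 0 = 0"
  by (simp add: mpoly_eval_def)

lemma eval_single:
  "mpoly_eval \<phi> v (Poly_Mapping.single m c)
    = \<phi> c * (\<Prod>x\<in>Poly_Mapping.keys m. v x ^ Poly_Mapping.lookup m x)"
  by (simp add: mpoly_eval_def zero)

lemma eval_add: "mpoly_eval \<phi> v (P + Q) = mpoly_eval \<phi> v P + mpoly_eval \<phi> v Q"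
  unfolding mpoly_eval_def
  by (rule setsum_keys_plus_distrib) (simp_all add: zero add algebra_simps)

lemma eval_mult: "mpoly_eval \<phi> v (P * Q) = mpoly_eval \<phi> v P * mpoly_eval \<phi> v Q"
proof (induction P rule: mpoly_induct)
  case (single m c)
  show ?case
  proof (induction Q rule: mpoly_induct)
    case (single n d)
    show ?case
      by (simp add: mult_single eval_single mon_eval_add mult ac_simps)
  qed (simp_all add: eval_zero eval_add distrib_left)
qed (simp_all add: eval_zero eval_add distrib_right)

lemma eval_const: "mpoly_eval \<phi> v (mpoly_const c) = \<phi> c"
  by (simp add: mpoly_const_def eval_single)

lemma eval_var: "mpoly_eval \<phi> v (mpoly_var x) = v x"
  by (simp add: mpoly_var_def eval_single one)

lemma eval_power: "mpoly_eval \<phi> v (P ^ k) = mpoly_eval \<phi> v P ^ k"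
proof (induction k)
  case 0
  show ?case using eval_const[of v 1] by (simp add: mpoly_const_def one)
qed (simp add: eval_mult)

lemma eval_prod: "mpoly_eval \<phi> v (\<Prod>x\<in>A. f x) = (\<Prod>x\<in>A. mpoly_eval \<phi> v (f x))"
proof (induction A rule: infinite_finite_induct)
  case empty
  show ?case using eval_power[of v 0 0] by simp
next
  case (infinite A)
  then show ?case using eval_power[of v 0 0] by simp
qed (simp add: eval_mult)

end

interpretation mpoly_const: mpoly_eval_hom mpoly_const
  by unfold_locales (simp_all add: mpoly_const_def single_add mult_single)

lemmas mpoly_rename_add = mpoly_const.eval_add[of "\<lambda>x. mpoly_var (f x)" for f, folded mpoly_rename_def]
lemmas mpoly_rename_mult = mpoly_const.eval_mult[of "\<lambda>x. mpoly_var (f x)" for f, folded mpoly_rename_def]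
lemmas mpoly_rename_zero = mpoly_const.eval_zero[of "\<lambda>x. mpoly_var (f x)" for f, folded mpoly_rename_def]
lemmas mpoly_rename_const = mpoly_const.eval_const[of "\<lambda>x. mpoly_var (f x)" for f, folded mpoly_rename_def]
lemmas mpoly_rename_var = mpoly_const.eval_var[of "\<lambda>x. mpoly_var (f x)" for f, folded mpoly_rename_def]

lemma single_eq_prod:
  "Poly_Mapping.single m c
    = mpoly_const c * (\<Prod>x\<in>Poly_Mapping.keys m. mpoly_var x ^ Poly_Mapping.lookup m x)"
proof -
  have pow: "mpoly_var x ^ k = Poly_Mapping.single (Poly_Mapping.single x k) (1 :: 'b)" for x :: 'a and k
    by (induction k) (simp_all add: mpoly_var_def mult_single flip: single_add)
  have prod: "(\<Prod>x\<in>A. Poly_Mapping.single (f x) (1 :: 'b)) = Poly_Mapping.single (\<Sum>x\<in>A. f x) 1"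
    for A and f :: "'a \<Rightarrow> 'a \<Rightarrow>\<^sub>0 nat"
    by (induction A rule: infinite_finite_induct) (simp_all add: mult_single)
  have "(\<Sum>x\<in>Poly_Mapping.keys m. Poly_Mapping.single x (Poly_Mapping.lookup m x)) = m"
    by (intro poly_mapping_eqI)
       (simp add: lookup_sum lookup_single when_def in_keys_iff)
  then show ?thesis
    by (simp add: pow prod mpoly_const_def mult_single)
qed

lemma mpoly_rename_id: "mpoly_rename (\<lambda>x. x) P = P"
proof (induction P rule: mpoly_induct)
  case (single m c)
  show ?case
    by (simp add: mpoly_rename_def mpoly_const.eval_single flip: single_eq_prod)
qed (simp_all add: mpoly_rename_zero mpoly_rename_add)

lemma mpoly_rename_comp: "mpoly_rename g (mpoly_rename f P) = mpoly_rename (\<lambda>x. g (f x)) P"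
proof (induction P rule: mpoly_induct)
  case (single m c)
  show ?case
    by (simp add: mpoly_rename_def mpoly_const.eval_single mpoly_const.eval_mult
        mpoly_const.eval_prod mpoly_const.eval_power mpoly_const.eval_const mpoly_const.eval_var)
qed (simp_all add: mpoly_rename_zero mpoly_rename_add)

lemma mpoly_rename_eq_0_iff:
  assumes "inj f"
  shows "mpoly_rename f P = 0 \<longleftrightarrow> P = 0"
proof
  assume "mpoly_rename f P = 0"
  then have "mpoly_rename (\<lambda>x. inv_into UNIV f (f x)) P = 0"
    by (metis mpoly_rename_comp mpoly_rename_zero)
  then show "P = 0"
    using assms by (simp add: mpoly_rename_id)
qed (simp add: mpoly_rename_zero)

definition ratfun_const :: "'a::field \<Rightarrow> ('g, 'a) ratfun" where
  "ratfun_const c = Fract (mpoly_const c) 1"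

definition ratfun_var :: "'g \<Rightarrow> ('g, 'a::field) ratfun" where
  "ratfun_var x = Fract (mpoly_var (Var x)) 1"

text \<open>Only meant for injective \<open>f\<close>; see \<open>ratfun_rename_Fract\<close>.\<close>

definition ratfun_rename :: "('g \<Rightarrow> 'g) \<Rightarrow> ('g, 'a::field) ratfun \<Rightarrow> ('g, 'a) ratfun" where
  "ratfun_rename f z = (THE w. \<exists>a b. b \<noteq> 0 \<and> z = Fract a b \<and>
     w = Fract (mpoly_rename (map_var f) a) (mpoly_rename (map_var f) b))"

lemma ratfun_rename_Fract:
  assumes "inj f" "b \<noteq> 0"
  shows "ratfun_rename f (Fract a b)
    = Fract (mpoly_rename (map_var f) a) (mpoly_rename (map_var f) b)"
proof -
  have inj: "inj (map_var f)"
    using assms(1) by (rule var.inj_map)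
  have "Fract (mpoly_rename (map_var f) c) (mpoly_rename (map_var f) d)
      = Fract (mpoly_rename (map_var f) a) (mpoly_rename (map_var f) b)"
    if "Fract a b = Fract c d" "d \<noteq> 0" for c d
    using that assms(2)
    by (simp add: eq_fract mpoly_rename_eq_0_iff[OF inj] flip: mpoly_rename_mult)
  then show ?thesis
    unfolding ratfun_rename_def using assms(2) by (intro the_equality) metis+
qed

text \<open>
  For injective \<open>f\<close>, \<open>ratfun_rename f\<close> is the endomorphism of the rational function field that
  fixes the constants and sends the variable indexed by \<open>x\<close> to the one indexed by \<open>f x\<close>.
\<close>

lemma
  fixes f :: "'g \<Rightarrow> 'g" and c :: "'a::field" and y z :: "('g, 'a) ratfun"
  assumes "inj f"
  shows ratfun_rename_const: "ratfun_rename f (ratfun_const c) = ratfun_const c"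
    and ratfun_rename_var: "ratfun_rename f (ratfun_var x :: ('g, 'a) ratfun) = ratfun_var (f x)"
    and ratfun_rename_add: "ratfun_rename f (y + z) = ratfun_rename f y + ratfun_rename f z"
    and ratfun_rename_mult: "ratfun_rename f (y * z) = ratfun_rename f y * ratfun_rename f z"
proof -
  have inj: "inj (map_var f)"
    using assms by (rule var.inj_map)
  have one: "mpoly_rename (map_var f) 1 = (1 :: ('g var, 'a) mpoly)"
    using mpoly_rename_const[of "map_var f" "1 :: 'a"] by (simp add: mpoly_const_def)
  show "ratfun_rename f (ratfun_const c) = ratfun_const c"
    by (simp add: ratfun_const_def ratfun_rename_Fract[OF assms] mpoly_rename_const one)
  show "ratfun_rename f (ratfun_var x :: ('g, 'a) ratfun) = ratfun_var (f x)"
    by (simp add: ratfun_var_def ratfun_rename_Fract[OF assms] mpoly_rename_var one)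
  show "ratfun_rename f (y + z) = ratfun_rename f y + ratfun_rename f z"
    by (cases y; cases z)
       (simp add: ratfun_rename_Fract[OF assms] mpoly_rename_eq_0_iff[OF inj]
         mpoly_rename_add mpoly_rename_mult)
  show "ratfun_rename f (y * z) = ratfun_rename f y * ratfun_rename f z"
    by (cases y; cases z)
       (simp add: ratfun_rename_Fract[OF assms] mpoly_rename_eq_0_iff[OF inj] mpoly_rename_mult)
qed

section \<open>Transcendence degree\<close>

text \<open>
  In both definitions the base field is embedded into the extension field \<open>'e\<close>
  by the homomorphism \<open>\<phi>\<close>.
\<close>

definition alg_independent :: "('a::field \<Rightarrow> 'e::field) \<Rightarrow> 'e set \<Rightarrow> bool" where
  "alg_independent \<phi> S \<longleftrightarrow>
    (\<forall>P. mpoly_vars P \<subseteq> S \<longrightarrow> mpoly_eval \<phi> (\<lambda>s. s) P = 0 \<longrightarrow> P = 0)"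

definition trdeg :: "('a::field \<Rightarrow> 'e::field) \<Rightarrow> 'e set \<Rightarrow> enat" where
  "trdeg \<phi> L = (SUP S \<in> {S. S \<subseteq> L \<and> finite S \<and> alg_independent \<phi> S}. enat (card S))"

section \<open>Essential dimension\<close>

text \<open>
  The function field of the regular representation \<open>V\<close> of \<open>G\<close>: coordinates on \<open>V\<close> are indexed
  by the elements of \<open>G\<close>, and \<open>g\<close> sends the coordinate of \<open>h\<close> to that of \<open>g h\<close>. (The dual of the
  regular representation is again regular.)
\<close>

definition regrep_field :: "('g, 'm) monoid_scheme \<Rightarrow> ('g, 'a::field) ratfun set" where
  "regrep_field G =
    generate_field ring_of_type_algebra (range ratfun_const \<union> ratfun_var ` carrier G)"

definition regrep_act ::
    "('g, 'm) monoid_scheme \<Rightarrow> 'g \<Rightarrow> ('g, 'a::field) ratfun \<Rightarrow> ('g, 'a) ratfun" where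
  "regrep_act G g = ratfun_rename (\<lambda>h. if h \<in> carrier G then g \<otimes>\<^bsub>G\<^esub> h else h)"

lemma inj_regrep_perm:
  assumes "Group.group G" "g \<in> carrier G"
  shows "inj (\<lambda>h. if h \<in> carrier G then g \<otimes>\<^bsub>G\<^esub> h else h)"
proof -
  interpret group G by fact
  show ?thesis
    using assms(2) by (auto simp: inj_on_def split: if_splits)
qed

lemma regrep_act_var:
  assumes "Group.group G" "g \<in> carrier G" "h \<in> carrier G"
  shows "regrep_act G g (ratfun_var h) = ratfun_var (g \<otimes>\<^bsub>G\<^esub> h)"
  using assms by (simp add: regrep_act_def ratfun_rename_var[OF inj_regrep_perm])

text \<open>The \<open>G\<close>-invariant fields \<open>F \<subseteq> L \<subseteq> F(V)\<close> on which \<open>G\<close> acts faithfully, for \<open>F = 'a\<close>.\<close>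

definition faithful_subfields :: "('g, 'm) monoid_scheme \<Rightarrow> ('g, 'a::field) ratfun set set" where
  "faithful_subfields G = {L.
     subfield L ring_of_type_algebra \<and> range ratfun_const \<subseteq> L \<and> L \<subseteq> regrep_field G \<and>
     (\<forall>g\<in>carrier G. regrep_act G g ` L \<subseteq> L) \<and>
     (\<forall>g\<in>carrier G. (\<forall>z\<in>L. regrep_act G g z = z) \<longrightarrow> g = \<one>\<^bsub>G\<^esub>)}"

text \<open>
  This is the description of the essential dimension by compressions of the regular representation,
  which computes the supremum over all \<open>G\<close>-torsors over all field extensions of \<open>F\<close>. The
  supremum itself ranges over fields of arbitrary types, so it is not a HOL definition.
\<close>

definition essential_dimension :: "'a::field itself \<Rightarrow> ('g, 'm) monoid_scheme \<Rightarrow> enat" where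
  "essential_dimension _ G =
    (INF L \<in> faithful_subfields G. trdeg (ratfun_const :: 'a \<Rightarrow> ('g, 'a) ratfun) L)"

definition weakly_tame :: "nat \<Rightarrow> ('g, 'm) monoid_scheme \<Rightarrow> bool" where
  "weakly_tame p G \<longleftrightarrow> (\<forall>N. N \<lhd> G \<longrightarrow> (\<exists>k. card N = p ^ k) \<longrightarrow> N = {\<one>\<^bsub>G\<^esub>})"

end

theory Submission
  imports Defs "HOL-Number_Theory.Residues"
begin

text \<open>
  The proof specialises along a place: a valuation ring of the field \<open>K\<close> of characteristic \<open>0\<close>
  together with a homomorphism to the field \<open>k\<close> of characteristic \<open>p\<close> whose kernel is the maximal
  ideal. As Gauss did for the \<open>p\<close>-adic valuation, one extends it to rational functions by
  reducing the coefficients of primitive polynomials. The extension commutes with the action of \<open>G\<close>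
  and has the same value group: every nonzero rational function becomes a unit after
  multiplication by a constant (\<open>place.exists_unit_multiple\<close>).

  Let \<open>L \<subseteq> K(V)\<close> be an invariant field on which \<open>G\<close> acts faithfully, let \<open>l\<close> consist of the
  reductions of the integral elements of \<open>L\<close>, and let \<open>L'\<close> be the field generated by \<open>l\<close> over \<open>k\<close>.
  It is invariant, and two things have to be shown
  (\<open>place.faithful_subfield_reduction\<close>).

  First, \<open>trdeg L' \<le> trdeg L\<close>. Algebraically independent elements of \<open>l\<close> lift to algebraically
  independent elements of \<open>L\<close>, because a relation between the lifts can be scaled until it reduces
  to a nontrivial relation (\<open>place.trdeg_reduction_le\<close>). That the generators \<open>l\<close> already determine
  the transcendence degree of \<open>L'\<close> is Steinitz exchange
  (\<open>field_hom.trdeg_base_closure_le\<close>).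

  Secondly, \<open>G\<close> acts faithfully on \<open>L'\<close>. The kernel \<open>N\<close> of the action is the inertia group of \<open>L\<close>.
  Suppose that \<open>g \<in> N\<close> moves some \<open>a \<in> L\<close> and that \<open>g\<^sup>m = 1\<close> with \<open>p\<close> not dividing \<open>m\<close>. Scale
  \<open>w = g a - a\<close> by a constant so that it becomes a unit, with reduction \<open>u \<noteq> 0\<close>. The sum of \<open>g\<^sup>i w\<close>
  over \<open>i < m\<close> telescopes to \<open>0\<close>, but each summand has the reduction \<open>u\<close> since \<open>g\<close> acts trivially on
  reductions. So \<open>m u = 0\<close>, which is absurd because \<open>m\<close> is invertible in \<open>k\<close>. Hence \<open>N\<close> is a \<open>p\<close>-group. As it is
  normal, weak tameness makes it trivial. The scaling is by an element of the base field, on which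
  \<open>G\<close> acts trivially; this is why there is no tame inertia.

  It remains to find places. For \<open>\<rat>\<close> the localisation of \<open>\<int>\<close> at \<open>p\<close> with its reduction map is one
  (\<open>place_rat\<close>). For an arbitrary field of characteristic \<open>0\<close>, Chevalley's extension argument
  produces a place with values in the algebraic closure of the field with \<open>p\<close> elements
  (\<open>exists_place\<close>), which is then composed with the embedding into \<open>k\<close>.
\<close>

section \<open>Subfields and algebraic elements\<close>

lemma ring_of_type_algebra_simps [simp]:
  "carrier ring_of_type_algebra = UNIV"
  "\<one>\<^bsub>ring_of_type_algebra\<^esub> = 1" "\<zero>\<^bsub>ring_of_type_algebra\<^esub> = 0"
  "x \<oplus>\<^bsub>ring_of_type_algebra\<^esub> y = x + y" "x \<otimes>\<^bsub>ring_of_type_algebra\<^esub> y = x * y"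
  by (simp_all add: ring_of_type_algebra_def)

lemma ring_of_type_algebra_uminus [simp]: "\<ominus>\<^bsub>ring_of_type_algebra\<^esub> x = - (x :: 'a::field)"
proof -
  interpret Ring.field "ring_of_type_algebra :: 'a ring" by (rule field_from_type_algebra)
  show ?thesis using minus_equality[of "- x" x] by simp
qed

lemma ring_of_type_algebra_inverse:
  assumes "(x :: 'a::field) \<noteq> 0"
  shows "inv\<^bsub>ring_of_type_algebra\<^esub> x = inverse x"
proof -
  interpret Ring.field "ring_of_type_algebra :: 'a ring" by (rule field_from_type_algebra)
  show ?thesis using comm_inv_char[of x "inverse x"] assms by simp
qed

lemma ring_of_type_algebra_pow [simp]: "x [^]\<^bsub>ring_of_type_algebra\<^esub> (n::nat) = (x :: 'a::field) ^ n"
proof -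
  interpret Ring.field "ring_of_type_algebra :: 'a ring" by (rule field_from_type_algebra)
  show ?thesis by (induction n) simp_all
qed

text \<open>
  Closure under \<open>inverse\<close> may be asked of all elements, zero included, since \<open>inverse 0 = 0\<close>.
\<close>
lemma subfield_type_iff:
  "subfield H (ring_of_type_algebra :: 'a::field ring) \<longleftrightarrow>
    1 \<in> H \<and> (\<forall>x\<in>H. \<forall>y\<in>H. x - y \<in> H \<and> x * y \<in> H) \<and> (\<forall>x\<in>H. inverse x \<in> H)"
proof -
  interpret Ring.field "ring_of_type_algebra :: 'a ring" by (rule field_from_type_algebra)
  show ?thesis
  proof (intro iffI)
    assume H: "subfield H (ring_of_type_algebra :: 'a ring)"
    note sr = subringE[OF subfieldE(1)[OF H], simplified]
    have "x - y \<in> H" if "x \<in> H" "y \<in> H" for x y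
      using sr(5)[OF that(2)] sr(7)[OF that(1)] by (metis add_uminus_conv_diff)
    moreover have "inverse x \<in> H" if "x \<in> H" for x
      using that sr(2) subfield_m_inv(1)[OF H, of x] by (cases "x = 0") (auto simp: ring_of_type_algebra_inverse)
    ultimately show "1 \<in> H \<and> (\<forall>x\<in>H. \<forall>y\<in>H. x - y \<in> H \<and> x * y \<in> H) \<and> (\<forall>x\<in>H. inverse x \<in> H)"
      using sr by auto
  next
    assume H: "1 \<in> H \<and> (\<forall>x\<in>H. \<forall>y\<in>H. x - y \<in> H \<and> x * y \<in> H) \<and> (\<forall>x\<in>H. inverse x \<in> H)"
    then have 0: "0 \<in> H" by (metis diff_self)
    with H have um: "- x \<in> H" if "x \<in> H" for x using that by (metis diff_0)
    show "subfield H (ring_of_type_algebra :: 'a ring)"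
    proof (intro subfieldI' subringI)
      show "x \<oplus>\<^bsub>ring_of_type_algebra\<^esub> y \<in> H" if "x \<in> H" "y \<in> H" for x y
        using that um H by (metis diff_minus_eq_add ring_of_type_algebra_simps(4))
    qed (use H um in \<open>auto simp: ring_of_type_algebra_inverse\<close>)
  qed
qed

locale type_subfield =
  fixes F :: "'a::field set"
  assumes subfield: "subfield F ring_of_type_algebra"
begin

lemma one: "1 \<in> F"
  and diff: "x \<in> F \<Longrightarrow> y \<in> F \<Longrightarrow> x - y \<in> F"
  and mult: "x \<in> F \<Longrightarrow> y \<in> F \<Longrightarrow> x * y \<in> F"
  and inverse: "x \<in> F \<Longrightarrow> inverse x \<in> F"
  using subfield unfolding subfield_type_iff by blast+

lemma zero: "0 \<in> F" using diff[OF one one] by simp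

lemma uminus: "x \<in> F \<Longrightarrow> - x \<in> F" using diff[OF zero] by simp

lemma add: "x \<in> F \<Longrightarrow> y \<in> F \<Longrightarrow> x + y \<in> F" using diff[of x "- y"] uminus by simp

lemma divide: "x \<in> F \<Longrightarrow> y \<in> F \<Longrightarrow> x / y \<in> F" using mult inverse by (simp add: field_class.field_divide_inverse)

lemma power: "x \<in> F \<Longrightarrow> x ^ n \<in> F" by (induction n) (auto intro: one mult)

lemma sum: "(\<And>i. i \<in> I \<Longrightarrow> f i \<in> F) \<Longrightarrow> sum f I \<in> F"
  by (induction I rule: infinite_finite_induct) (auto intro: zero add)

lemma prod: "(\<And>i. i \<in> I \<Longrightarrow> f i \<in> F) \<Longrightarrow> prod f I \<in> F"
  by (induction I rule: infinite_finite_induct) (auto intro: one mult)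

end

lemma subfield_generate_field: "subfield (generate_field ring_of_type_algebra H) (ring_of_type_algebra :: 'a::field ring)"
  by (intro field.generate_field_is_subfield field_from_type_algebra) simp

lemma generate_field_le:
  assumes "subfield F (ring_of_type_algebra :: 'a::field ring)" "H \<subseteq> F"
  shows "generate_field ring_of_type_algebra H \<subseteq> F"
  using field.generate_field_min_subfield1[OF field_from_type_algebra _ assms] by simp

lemma generate_field_ge: "H \<subseteq> generate_field R H"
  by (auto intro: generate_field.incl)

text \<open>
  The type-level form of being algebraic over a subfield. The theory of finite
  extensions inside a carrier is transferred to it, so that polynomials can be handled as elements
  of \<^typ>\<open>'a poly\<close>.
\<close>
definition algebraic_over :: "'a::field set \<Rightarrow> 'a \<Rightarrow> bool" where
  "algebraic_over F x \<longleftrightarrow> (\<exists>q. q \<noteq> 0 \<and> (\<forall>i. poly.coeff q i \<in> F) \<and> poly q x = 0)"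

lemma algebraic_over_mono: "algebraic_over F x \<Longrightarrow> F \<subseteq> F' \<Longrightarrow> algebraic_over F' x"
  unfolding algebraic_over_def by blast

lemma eval_ring_of_type_algebra:
  "ring.eval ring_of_type_algebra p x = poly (Poly (rev p)) (x :: 'a::field)"
proof -
  interpret Ring.field "ring_of_type_algebra :: 'a ring" by (rule field_from_type_algebra)
  show ?thesis
    by (induction p) (simp_all add: Poly_append poly_monom algebra_simps)
qed

lemma algebraic_over_iff:
  assumes "subfield F (ring_of_type_algebra :: 'a::field ring)"
  shows "(ring.algebraic ring_of_type_algebra over F) x \<longleftrightarrow> algebraic_over F x"
proof -
  interpret Ring.field "ring_of_type_algebra :: 'a ring" by (rule field_from_type_algebra)
  interpret F: type_subfield F using assms by (rule type_subfield.intro)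
  show ?thesis
  proof
    assume "(algebraic over F) x"
    then obtain p where p: "p \<in> carrier (univ_poly ring_of_type_algebra F)" "p \<noteq> []" "eval p x = 0"
      using algebraicE[OF subfieldE(1)[OF assms], of x] by auto
    then have pF: "set p \<subseteq> F" and hd: "hd p \<noteq> 0"
      by (auto simp: univ_poly_def polynomial_def)
    have "poly.coeff (Poly (rev p)) (length p - 1) \<noteq> 0"
      using hd p(2) by (simp add: nth_default_def rev_nth hd_conv_nth)
    then have "Poly (rev p) \<noteq> 0" by force
    moreover have "poly.coeff (Poly (rev p)) i \<in> F" for i
      using pF F.zero by (auto simp: nth_default_def rev_nth)
    ultimately show "algebraic_over F x"
      using p(3) unfolding algebraic_over_def eval_ring_of_type_algebra by blast
  next
    assume "algebraic_over F x"
    then obtain q where q: "q \<noteq> 0" "\<And>i. poly.coeff q i \<in> F" "poly q x = 0"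
      unfolding algebraic_over_def by blast
    have "rev (coeffs q) \<in> carrier (univ_poly ring_of_type_algebra F)"
      using q by (auto simp: univ_poly_def polynomial_def hd_rev last_coeffs_eq_coeff_degree in_set_conv_nth coeffs_nth length_coeffs)
    then show "(algebraic over F) x"
      using q by (intro algebraicI[of "rev (coeffs q)"]) (auto simp: eval_ring_of_type_algebra)
  qed
qed

lemma algebraic_over_self:
  assumes "subfield F (ring_of_type_algebra :: 'a::field ring)" "x \<in> F"
  shows "algebraic_over F x"
proof -
  interpret F: type_subfield F using assms(1) by (rule type_subfield.intro)
  show ?thesis unfolding algebraic_over_def
    by (rule exI[of _ "[:-x, 1:]"]) (auto simp: coeff_pCons assms F.uminus F.one F.zero split: nat.splits)
qed

lemma subfield_algebraic_over:
  assumes "subfield F (ring_of_type_algebra :: 'a::field ring)"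
  shows "subfield {x. algebraic_over F x} ring_of_type_algebra"
  using field.subfield_of_algebraics[OF field_from_type_algebra assms]
  by (simp add: algebraic_over_iff[OF assms])

text \<open>
  The coefficients of a polynomial with root \<open>y\<close> generate a finite extension \<open>E\<close> of \<open>F\<close>, and \<open>E(y)\<close>
  is finite over \<open>E\<close>, so \<open>E(y)\<close> has finite dimension over \<open>F\<close>.
\<close>
lemma algebraic_over_trans:
  assumes F: "subfield F (ring_of_type_algebra :: 'a::field ring)"
    and "algebraic_over {x. algebraic_over F x} y"
  shows "algebraic_over F y"
proof -
  interpret Ring.field "ring_of_type_algebra :: 'a ring" by (rule field_from_type_algebra)
  obtain q where q: "q \<noteq> 0" "\<And>i. algebraic_over F (poly.coeff q i)" "poly q y = 0"
    using assms(2) unfolding algebraic_over_def[of "Collect _"] by blast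
  let ?E = "finite_extension F (coeffs q)"
  have alg: "(algebraic over F) x" if "x \<in> set (coeffs q)" for x
    using that q(1,2) by (auto simp: algebraic_over_iff[OF F] in_set_conv_nth coeffs_nth length_coeffs)
  have E: "subfield ?E ring_of_type_algebra"
    using finite_extension_is_subfield[OF F _ alg] by simp
  have "set (coeffs q) \<subseteq> ?E"
    using finite_extension_mem[OF subfieldE(1)[OF F]] by simp
  then have "poly.coeff q i \<in> ?E" for i
    using coeff_in_coeffs[OF q(1), of i] subringE(2)[OF subfieldE(1)[OF E]]
    by (cases "i \<le> degree q") (auto simp: coeff_eq_0)
  then have y: "(algebraic over ?E) y"
    using q unfolding algebraic_over_iff[OF E] algebraic_over_def by blast
  have "finite_dimension F ?E"
    using finite_extension_finite_dimension(1)[OF F _ alg] by simp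
  moreover have "finite_dimension ?E (simple_extension ?E y)"
    using y finite_dimension_simple_extension[OF E, of y] by simp
  ultimately have "finite_dimension F (simple_extension ?E y)"
    by (rule telescopic_base_dim(1)[OF F E])
  then show ?thesis
    using finite_dimension_imp_algebraic[OF F simple_extension_is_subring[OF subfieldE(1)[OF E], of y], of y]
      simple_extension_mem[OF subfieldE(1)[OF E], of y]
    by (simp add: algebraic_over_iff[OF F])
qed

section \<open>Algebraic independence and the transcendence degree\<close>

lemma mpoly_eval_cong:
  assumes "\<And>x. x \<in> mpoly_vars P \<Longrightarrow> v x = w x"
  shows "mpoly_eval \<phi> v P = mpoly_eval \<phi> w P"
  unfolding mpoly_eval_def
proof (intro sum.cong prod.cong refl arg_cong2[of _ _ _ _ "(*)"])
  fix m x assume "m \<in> Poly_Mapping.keys P" "x \<in> Poly_Mapping.keys m"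
  then have "x \<in> mpoly_vars P" by (auto simp: mpoly_vars_def)
  then show "v x ^ Poly_Mapping.lookup m x = w x ^ Poly_Mapping.lookup m x" by (simp add: assms)
qed

lemma mpoly_vars_zero [simp]: "mpoly_vars 0 = {}"
  by (simp add: mpoly_vars_def)

lemma mpoly_vars_const [simp]: "mpoly_vars (mpoly_const c) = {}"
  by (auto simp: mpoly_vars_def mpoly_const_def split: if_splits)

lemma mpoly_vars_var [simp]: "mpoly_vars (mpoly_var x :: ('x, 'a::comm_semiring_1) mpoly) = {x}"
  by (simp add: mpoly_vars_def mpoly_var_def)

lemma mpoly_vars_single: "mpoly_vars (Poly_Mapping.single m c) \<subseteq> Poly_Mapping.keys m"
  by (auto simp: mpoly_vars_def split: if_splits)

lemma mpoly_vars_add: "mpoly_vars (P + Q) \<subseteq> mpoly_vars P \<union> mpoly_vars Q"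
  using keys_add[of P Q] by (auto simp: mpoly_vars_def)

lemma mpoly_vars_mult: "mpoly_vars (P * Q) \<subseteq> mpoly_vars P \<union> mpoly_vars Q"
proof
  fix x assume "x \<in> mpoly_vars (P * Q)"
  then obtain m where m: "m \<in> Poly_Mapping.keys (P * Q)" "x \<in> Poly_Mapping.keys m"
    by (auto simp: mpoly_vars_def)
  then obtain a b where "a \<in> Poly_Mapping.keys P" "b \<in> Poly_Mapping.keys Q" "m = a + b"
    using keys_mult[of P Q] by auto
  then show "x \<in> mpoly_vars P \<union> mpoly_vars Q"
    using m(2) keys_add[of a b] by (auto simp: mpoly_vars_def)
qed

lemma mpoly_vars_uminus [simp]: "mpoly_vars (- P :: ('x, 'a::comm_ring_1) mpoly) = mpoly_vars P"
proof -
  have "Poly_Mapping.keys (- P) = Poly_Mapping.keys P"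
    by (rule Set.set_eqI) (simp only: in_keys_iff lookup_uminus neg_equal_0_iff_equal)
  then show ?thesis by (simp add: mpoly_vars_def)
qed

lemma mpoly_vars_diff: "mpoly_vars (P - Q :: ('x, 'a::comm_ring_1) mpoly) \<subseteq> mpoly_vars P \<union> mpoly_vars Q"
  using mpoly_vars_add[of P "- Q"] by simp

lemma mpoly_vars_sum: "mpoly_vars (\<Sum>i\<in>I. f i) \<subseteq> (\<Union>i\<in>I. mpoly_vars (f i))"
proof (induction I rule: infinite_finite_induct)
  case (insert i I)
  then show ?case using mpoly_vars_add[of "f i" "sum f I"] by auto
qed auto

lemma mpoly_vars_power_var: "mpoly_vars (mpoly_var x ^ n :: ('x, 'a::comm_semiring_1) mpoly) \<subseteq> {x}"
proof (induction n)
  case 0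
  show ?case by (simp add: mpoly_vars_def)
next
  case (Suc n)
  then show ?case using mpoly_vars_mult[of "mpoly_var x" "mpoly_var x ^ n"] by auto
qed

lemma mpoly_rename_eq_self:
  assumes "\<And>x. x \<in> mpoly_vars P \<Longrightarrow> f x = x"
  shows "mpoly_rename f P = P"
proof -
  have "mpoly_rename f P = mpoly_rename (\<lambda>x. x) P"
    unfolding mpoly_rename_def by (rule mpoly_eval_cong) (simp add: assms)
  then show ?thesis by (simp add: mpoly_rename_id)
qed

context mpoly_eval_hom
begin

lemma eval_sum: "mpoly_eval \<phi> v (\<Sum>i\<in>I. f i) = (\<Sum>i\<in>I. mpoly_eval \<phi> v (f i))"
  by (induction I rule: infinite_finite_induct) (simp_all add: eval_zero eval_add)

lemma eval_one: "mpoly_eval \<phi> v 1 = 1"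
  using eval_power[of v 0 0] by simp

lemma eval_rename: "mpoly_eval \<phi> v (mpoly_rename f P) = mpoly_eval \<phi> (\<lambda>x. v (f x)) P"
proof (induction P rule: mpoly_induct)
  case (single m c)
  show ?case
    by (simp add: mpoly_rename_def mpoly_const.eval_single eval_single eval_mult eval_const
        eval_prod eval_power eval_var)
qed (simp_all add: eval_zero eval_add mpoly_rename_zero mpoly_rename_add)

end

lemma mpoly_vars_rename:
  fixes f :: "'x \<Rightarrow> 'y" and P :: "('x, 'a::comm_semiring_1) mpoly"
  shows "mpoly_vars (mpoly_rename f P) \<subseteq> f ` mpoly_vars P"
proof
  fix y assume "y \<in> mpoly_vars (mpoly_rename f P)"
  then obtain m where m: "m \<in> Poly_Mapping.keys P"
      "y \<in> mpoly_vars (mpoly_const (Poly_Mapping.lookup P m)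
         * (\<Prod>x\<in>Poly_Mapping.keys m. mpoly_var (f x) ^ Poly_Mapping.lookup m x))"
    unfolding mpoly_rename_def mpoly_eval_def by (auto dest!: subsetD[OF mpoly_vars_sum])
  have vars: "mpoly_vars (mpoly_const c * (\<Prod>x\<in>A. mpoly_var (f x) ^ k x)) \<subseteq> f ` A" for c :: 'a and A k
  proof -
    have "mpoly_vars (\<Prod>x\<in>A. mpoly_var (f x) ^ k x :: ('y, 'a) mpoly) \<subseteq> f ` A"
    proof (induction A rule: infinite_finite_induct)
      case (insert x A)
      then show ?case
        using mpoly_vars_mult[of "mpoly_var (f x) ^ k x" "\<Prod>x\<in>A. mpoly_var (f x) ^ k x"]
          mpoly_vars_power_var[of "f x" "k x"] by fastforce
    qed (simp_all add: mpoly_vars_def)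
    then show ?thesis
      using mpoly_vars_mult[of "mpoly_const c" "\<Prod>x\<in>A. mpoly_var (f x) ^ k x"] by auto
  qed
  have "y \<in> f ` Poly_Mapping.keys m"
    using m(2) by (rule subsetD[OF vars, rotated])
  then show "y \<in> f ` mpoly_vars P"
    using m(1) by (auto simp: mpoly_vars_def)
qed

text \<open>The coefficient of the \<open>i\<close>-th power of the variable \<open>y\<close> in \<open>P\<close>, a polynomial in the other variables.\<close>
definition mpoly_slice :: "'x \<Rightarrow> nat \<Rightarrow> ('x, 'a::comm_semiring_1) mpoly \<Rightarrow> ('x, 'a) mpoly" where
  "mpoly_slice y i P = (\<Sum>m\<in>{m\<in>Poly_Mapping.keys P. Poly_Mapping.lookup m y = i}.
     Poly_Mapping.single (Poly_Mapping.update y 0 m) (Poly_Mapping.lookup P m))"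

lemma keys_update_0: "Poly_Mapping.keys (Poly_Mapping.update y 0 m) = Poly_Mapping.keys m - {y}"
  by (rule Set.set_eqI) (simp only: in_keys_iff lookup_update Diff_iff insert_iff empty_iff split: if_splits, auto)

lemma mpoly_vars_slice: "mpoly_vars (mpoly_slice y i P) \<subseteq> mpoly_vars P - {y}"
proof -
  have "mpoly_vars (Poly_Mapping.single (Poly_Mapping.update y 0 m) c) \<subseteq> mpoly_vars P - {y}"
    if "m \<in> Poly_Mapping.keys P" for m and c :: 'b
    using mpoly_vars_single[of "Poly_Mapping.update y 0 m" c] that
    by (auto simp: keys_update_0 mpoly_vars_def)
  then show ?thesis
    unfolding mpoly_slice_def using mpoly_vars_sum by fastforce
qed

lemma mpoly_slice_neq_0:
  assumes "m \<in> Poly_Mapping.keys P"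
  shows "mpoly_slice y (Poly_Mapping.lookup m y) P \<noteq> 0"
proof -
  let ?M = "{n \<in> Poly_Mapping.keys P. Poly_Mapping.lookup n y = Poly_Mapping.lookup m y}"
  have inj: "n = m" if "Poly_Mapping.lookup n y = Poly_Mapping.lookup m y"
    "Poly_Mapping.update y 0 n = Poly_Mapping.update y 0 m" for n
  proof (rule poly_mapping_eqI)
    fix x
    show "Poly_Mapping.lookup n x = Poly_Mapping.lookup m x"
      using that(1) arg_cong[OF that(2), of "\<lambda>f. Poly_Mapping.lookup f x"]
      by (simp add: lookup_update split: if_splits)
  qed
  have "Poly_Mapping.lookup (mpoly_slice y (Poly_Mapping.lookup m y) P) (Poly_Mapping.update y 0 m)
    = (\<Sum>n\<in>?M. if n = m then Poly_Mapping.lookup P m else 0)"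
    unfolding mpoly_slice_def lookup_sum
    by (rule sum.cong) (auto simp: lookup_single when_def dest: inj)
  also have "\<dots> = Poly_Mapping.lookup P m"
    using assms by (simp add: sum.delta)
  finally show ?thesis
    using assms by (auto simp: in_keys_iff)
qed

lemma prod_const_poly: "(\<Prod>x\<in>A. [:f x:]) = [:\<Prod>x\<in>A. f x:]"
  by (induction A rule: infinite_finite_induct) (simp_all add: one_pCons mult.commute)

text \<open>
  Evaluation at the elements that serve as variables, except that \<open>y\<close> is kept as an indeterminate.
  A relation between \<open>y\<close> and a set of elements becomes in this way a polynomial with root \<open>y\<close>.
\<close>
definition mpoly_to_poly :: "('a \<Rightarrow> 'e) \<Rightarrow> 'e \<Rightarrow> ('e::field, 'a::field) mpoly \<Rightarrow> 'e poly" where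
  "mpoly_to_poly \<phi> y = mpoly_eval (\<lambda>c. [:\<phi> c:]) (\<lambda>x. if x = y then [:0, 1:] else [:x:])"

lemma poly_mpoly_to_poly: "poly (mpoly_to_poly \<phi> y P) y = mpoly_eval \<phi> (\<lambda>x. x) P"
proof -
  have eq: "poly (if x = y then [:0, 1:] else [:x:]) y = x" for x by simp
  show ?thesis
    unfolding mpoly_to_poly_def mpoly_eval_def by (simp add: poly_sum poly_prod eq)
qed

locale field_hom = mpoly_eval_hom \<phi> for \<phi> :: "'a::field \<Rightarrow> 'e::field"
begin

lemma hom_poly: "mpoly_eval_hom (\<lambda>c. [:\<phi> c:])"
  by unfold_locales (simp_all add: zero one add mult one_pCons)

lemma diff: "\<phi> (a - b) = \<phi> a - \<phi> b"
  using add[of "a - b" b] by (simp add: algebra_simps)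

lemma uminus: "\<phi> (- b) = - \<phi> b"
  using diff[of 0 b] by (simp add: zero)

lemma eq_0_iff: "\<phi> a = 0 \<longleftrightarrow> a = 0"
  using mult[of a "inverse a"] by (cases "a = 0") (auto simp: zero one)

lemma inverse: "\<phi> (inverse a) = inverse (\<phi> a)"
proof (cases "a = 0")
  case False
  then have "\<phi> a * \<phi> (inverse a) = 1" by (simp flip: mult add: one)
  then show ?thesis by (metis inverse_unique)
qed (simp add: zero)

lemma eval_uminus: "mpoly_eval \<phi> v (- P) = - mpoly_eval \<phi> v P"
  using eval_add[of v P "- P"] by (simp add: eval_zero minus_unique)

lemma eval_diff: "mpoly_eval \<phi> v (P - Q) = mpoly_eval \<phi> v P - mpoly_eval \<phi> v Q"
  using eval_add[of v P "- Q"] by (simp add: eval_uminus)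

lemma coeff_mpoly_to_poly:
  "poly.coeff (mpoly_to_poly \<phi> y P) i = mpoly_eval \<phi> (\<lambda>x. x) (mpoly_slice y i P)"
proof -
  let ?v = "\<lambda>x. if x = y then [:0, 1:] else [:x:]"
  let ?e = "\<lambda>m. (\<Prod>x\<in>Poly_Mapping.keys m - {y}. x ^ Poly_Mapping.lookup m x)"
  have prod: "(\<Prod>x\<in>Poly_Mapping.keys m. ?v x ^ Poly_Mapping.lookup m x)
    = Polynomial.monom (?e m) (Poly_Mapping.lookup m y)" for m :: "'e \<Rightarrow>\<^sub>0 nat"
  proof -
    have "(\<Prod>x\<in>Poly_Mapping.keys m. ?v x ^ Poly_Mapping.lookup m x)
      = (\<Prod>x\<in>insert y (Poly_Mapping.keys m). ?v x ^ Poly_Mapping.lookup m x)"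
      by (rule mon_eval_superset) auto
    also have "\<dots> = [:0, 1:] ^ Poly_Mapping.lookup m y
        * (\<Prod>x\<in>Poly_Mapping.keys m - {y}. ?v x ^ Poly_Mapping.lookup m x)"
      by (simp add: prod.insert_remove)
    also have "(\<Prod>x\<in>Poly_Mapping.keys m - {y}. ?v x ^ Poly_Mapping.lookup m x)
      = (\<Prod>x\<in>Poly_Mapping.keys m - {y}. [:x ^ Poly_Mapping.lookup m x:])"
      by (rule prod.cong) (auto simp: poly_const_pow)
    also have "\<dots> = [:?e m:]"
      by (rule prod_const_poly)
    also have "[:0, 1:] ^ Poly_Mapping.lookup m y * [:?e m:]
      = Polynomial.monom (?e m) (Poly_Mapping.lookup m y)"
      by (simp add: monom_altdef)
    finally show ?thesis .
  qed
  have "poly.coeff (mpoly_to_poly \<phi> y P) i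
    = (\<Sum>m\<in>Poly_Mapping.keys P. if Poly_Mapping.lookup m y = i then \<phi> (Poly_Mapping.lookup P m) * ?e m else 0)"
    unfolding mpoly_to_poly_def mpoly_eval_def prod coeff_sum
    by (rule sum.cong) (auto)
  also have "\<dots> = (\<Sum>m\<in>{m\<in>Poly_Mapping.keys P. Poly_Mapping.lookup m y = i}. \<phi> (Poly_Mapping.lookup P m) * ?e m)"
    by (rule sum.inter_filter [symmetric]) simp
  also have "\<dots> = mpoly_eval \<phi> (\<lambda>x. x) (mpoly_slice y i P)"
    unfolding mpoly_slice_def eval_sum eval_single keys_update_0
    by (intro sum.cong prod.cong refl arg_cong2[of _ _ _ _ "(*)"]) (auto simp: lookup_update)
  finally show ?thesis .
qed

end

lemma mpoly_vars_mult_le: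
  "mpoly_vars P \<subseteq> S \<Longrightarrow> mpoly_vars Q \<subseteq> S \<Longrightarrow> mpoly_vars (P * Q) \<subseteq> S"
  by (rule order_trans[OF mpoly_vars_mult]) simp

lemma mpoly_vars_diff_le:
  fixes P Q :: "('x, 'a::comm_ring_1) mpoly"
  shows "mpoly_vars P \<subseteq> S \<Longrightarrow> mpoly_vars Q \<subseteq> S \<Longrightarrow> mpoly_vars (P - Q) \<subseteq> S"
  by (rule order_trans[OF mpoly_vars_diff]) simp

lemma mpoly_vars_sum_le: "(\<And>i. i \<in> I \<Longrightarrow> mpoly_vars (f i) \<subseteq> S) \<Longrightarrow> mpoly_vars (\<Sum>i\<in>I. f i) \<subseteq> S"
  by (rule order_trans[OF mpoly_vars_sum]) auto

lemma mpoly_vars_one [simp]: "mpoly_vars 1 = {}"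
  by (simp add: mpoly_vars_def)

lemma mpoly_vars_prod_le: "(\<And>i. i \<in> I \<Longrightarrow> mpoly_vars (f i) \<subseteq> S) \<Longrightarrow> mpoly_vars (\<Prod>i\<in>I. f i) \<subseteq> S"
  by (induction I rule: infinite_finite_induct) (simp_all add: mpoly_vars_mult_le)

context field_hom
begin

definition base_closure :: "'e set \<Rightarrow> 'e set" where
  "base_closure S = generate_field ring_of_type_algebra (range \<phi> \<union> S)"

definition alg_closure_in :: "'e set \<Rightarrow> 'e set" where
  "alg_closure_in S = {x. algebraic_over (base_closure S) x}"

lemma subfield_base_closure: "subfield (base_closure S) ring_of_type_algebra"
  unfolding base_closure_def by (rule subfield_generate_field)

lemma base_closure_ge: "range \<phi> \<subseteq> base_closure S" "S \<subseteq> base_closure S"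
  unfolding base_closure_def using generate_field_ge[of "range \<phi> \<union> S" ring_of_type_algebra] by auto

lemma base_closure_le:
  "subfield F ring_of_type_algebra \<Longrightarrow> range \<phi> \<subseteq> F \<Longrightarrow> S \<subseteq> F \<Longrightarrow> base_closure S \<subseteq> F"
  unfolding base_closure_def by (rule generate_field_le) auto

lemma subfield_alg_closure_in: "subfield (alg_closure_in S) ring_of_type_algebra"
  unfolding alg_closure_in_def by (rule subfield_algebraic_over[OF subfield_base_closure])

lemma base_closure_subset_alg_closure_in: "base_closure S \<subseteq> alg_closure_in S"
  unfolding alg_closure_in_def using algebraic_over_self[OF subfield_base_closure] by blast

lemma subset_alg_closure_in: "S \<subseteq> alg_closure_in S"
  using base_closure_ge(2)[of S] base_closure_subset_alg_closure_in[of S] by (rule order_trans)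

lemma alg_closure_in_le:
  assumes "T \<subseteq> alg_closure_in S"
  shows "alg_closure_in T \<subseteq> alg_closure_in S"
proof
  fix x assume "x \<in> alg_closure_in T"
  moreover have "base_closure T \<subseteq> alg_closure_in S"
    using assms base_closure_ge[of S] base_closure_subset_alg_closure_in[of S]
    by (intro base_closure_le subfield_alg_closure_in) auto
  ultimately have "algebraic_over (alg_closure_in S) x"
    unfolding alg_closure_in_def[of T] using algebraic_over_mono by blast
  then show "x \<in> alg_closure_in S"
    unfolding alg_closure_in_def using algebraic_over_trans[OF subfield_base_closure] by blast
qed

lemma eval_in_base_closure:
  assumes "mpoly_vars P \<subseteq> S"
  shows "mpoly_eval \<phi> (\<lambda>x. x) P \<in> base_closure S"
proof -
  interpret F: type_subfield "base_closure S"
    using subfield_base_closure by (rule type_subfield.intro)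
  have "\<phi> c \<in> base_closure S" for c
    using base_closure_ge(1) by blast
  moreover have "x \<in> base_closure S" if "m \<in> Poly_Mapping.keys P" "x \<in> Poly_Mapping.keys m" for m x
    using that assms base_closure_ge(2)[of S] by (auto simp: mpoly_vars_def)
  ultimately show ?thesis
    unfolding mpoly_eval_def by (intro F.sum F.mult F.prod F.power)
qed

text \<open>The fractions of values of polynomials form a subfield that contains the generators.\<close>
lemma base_closure_fraction:
  assumes "x \<in> base_closure S"
  obtains U V where "mpoly_vars U \<subseteq> S" "mpoly_vars V \<subseteq> S" "mpoly_eval \<phi> (\<lambda>x. x) V \<noteq> 0"
    "x = mpoly_eval \<phi> (\<lambda>x. x) U / mpoly_eval \<phi> (\<lambda>x. x) V"
proof -
  let ?ev = "mpoly_eval \<phi> (\<lambda>x. x)"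
  let ?Q = "{?ev U / ?ev V | U V. mpoly_vars U \<subseteq> S \<and> mpoly_vars V \<subseteq> S \<and> ?ev V \<noteq> 0}"
  have memI: "z \<in> ?Q" if "z = ?ev U / ?ev V" "mpoly_vars U \<subseteq> S" "mpoly_vars V \<subseteq> S" "?ev V \<noteq> 0" for z U V
    using that by blast
  have polyI: "?ev U \<in> ?Q" if "mpoly_vars U \<subseteq> S" for U
    by (rule memI[of _ U 1]) (use that in \<open>auto simp: eval_one\<close>)
  have "subfield ?Q ring_of_type_algebra"
    unfolding subfield_type_iff
  proof (intro conjI ballI)
    show "1 \<in> ?Q"
      using polyI[of "mpoly_const 1"] by (simp add: eval_const one)
  next
    fix x y assume "x \<in> ?Q" "y \<in> ?Q"
    then obtain U V U' V' where *: "x = ?ev U / ?ev V" "y = ?ev U' / ?ev V'"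
      "?ev V \<noteq> 0" "?ev V' \<noteq> 0" "mpoly_vars U \<subseteq> S" "mpoly_vars V \<subseteq> S"
      "mpoly_vars U' \<subseteq> S" "mpoly_vars V' \<subseteq> S" by blast
    have "mpoly_vars (U * V' - U' * V) \<subseteq> S" "mpoly_vars (V * V') \<subseteq> S" "mpoly_vars (U * U') \<subseteq> S"
      using *(5-8) by (simp_all add: mpoly_vars_diff_le mpoly_vars_mult_le)
    moreover have "x - y = ?ev (U * V' - U' * V) / ?ev (V * V')" "x * y = ?ev (U * U') / ?ev (V * V')"
      "?ev (V * V') \<noteq> 0"
      unfolding *(1,2) eval_mult eval_diff using *(3,4) by (simp_all add: diff_frac_eq)
    ultimately show "x - y \<in> ?Q" "x * y \<in> ?Q"
      by (iprover intro: memI)+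
  next
    fix x assume "x \<in> ?Q"
    then obtain U V where *: "x = ?ev U / ?ev V" "?ev V \<noteq> 0" "mpoly_vars U \<subseteq> S" "mpoly_vars V \<subseteq> S"
      by blast
    show "inverse x \<in> ?Q"
    proof (cases "?ev U = 0")
      case True
      then show ?thesis using polyI[of 0] * by (simp add: eval_zero)
    next
      case False
      then show ?thesis using * by (intro memI[of _ V U]) auto
    qed
  qed
  moreover have "range \<phi> \<subseteq> ?Q"
  proof
    fix z assume "z \<in> range \<phi>"
    then obtain c where "z = ?ev (mpoly_const c)" by (auto simp: eval_const)
    then show "z \<in> ?Q" using polyI[of "mpoly_const c"] by (simp only: mpoly_vars_const empty_subsetI)
  qed
  moreover have "S \<subseteq> ?Q"
  proof
    fix z assume "z \<in> S"
    then show "z \<in> ?Q" using polyI[of "mpoly_var z"] by (simp add: eval_var)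
  qed
  ultimately have "base_closure S \<subseteq> ?Q"
    by (rule base_closure_le)
  with assms obtain U V where "mpoly_vars U \<subseteq> S" "mpoly_vars V \<subseteq> S" "?ev V \<noteq> 0" "x = ?ev U / ?ev V"
    by blast
  then show thesis by (rule that)
qed

lemma alg_independent_mono: "alg_independent \<phi> T \<Longrightarrow> S \<subseteq> T \<Longrightarrow> alg_independent \<phi> S"
  unfolding alg_independent_def by blast

lemma alg_independent_empty: "alg_independent \<phi> {}"
  unfolding alg_independent_def
proof (intro allI impI)
  fix P :: "('e, 'a) mpoly"
  assume "mpoly_vars P \<subseteq> {}" and ev: "mpoly_eval \<phi> (\<lambda>s. s) P = 0"
  then have keys: "m = 0" if "m \<in> Poly_Mapping.keys P" for m
    using that by (auto simp: mpoly_vars_def)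
  have "P = mpoly_const (Poly_Mapping.lookup P 0)"
    unfolding mpoly_const_def
    by (rule poly_mapping_eqI)
       (metis keys lookup_single_eq lookup_single_not_eq lookup_not_eq_zero_eq_in_keys)
  with ev show "P = 0"
    by (metis eval_const eq_0_iff mpoly_const.zero)
qed

lemma mpoly_to_poly_no_var:
  assumes "y \<notin> mpoly_vars U"
  shows "mpoly_to_poly \<phi> y U = [:mpoly_eval \<phi> (\<lambda>x. x) U:]"
proof -
  have "mpoly_to_poly \<phi> y U = mpoly_eval (\<lambda>c. [:\<phi> c:]) (\<lambda>x. [:x:]) U"
    unfolding mpoly_to_poly_def by (rule mpoly_eval_cong) (use assms in auto)
  also have "\<dots> = [:mpoly_eval \<phi> (\<lambda>x. x) U:]"
    unfolding mpoly_eval_def by (simp add: poly_const_pow prod_const_poly sum_to_poly mult.commute)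
  finally show ?thesis .
qed

text \<open>
  This translates between algebraic independence and algebraic closure. A relation that involves
  \<open>y\<close> is read as a polynomial with root \<open>y\<close>; its coefficients do not all vanish since \<open>S\<close> is
  independent. Conversely, clearing the denominators of a polynomial with root \<open>y\<close> gives a relation.
\<close>
lemma alg_independent_insert:
  assumes S: "alg_independent \<phi> S" and y: "y \<notin> S"
  shows "alg_independent \<phi> (insert y S) \<longleftrightarrow> y \<notin> alg_closure_in S"
proof -
  let ?ev = "mpoly_eval \<phi> (\<lambda>x. x)"
  have "y \<in> alg_closure_in S" if dep: "\<not> alg_independent \<phi> (insert y S)"
  proof -
    obtain P where P: "mpoly_vars P \<subseteq> insert y S" "?ev P = 0" "P \<noteq> 0"
      using dep unfolding alg_independent_def by blast
    then have "Poly_Mapping.keys P \<noteq> {}" by simp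
    then obtain m where m: "m \<in> Poly_Mapping.keys P" by blast
    let ?q = "mpoly_to_poly \<phi> y P"
    have vars: "mpoly_vars (mpoly_slice y i P) \<subseteq> S" for i
      using mpoly_vars_slice[of y i P] P(1) by auto
    have "?ev (mpoly_slice y (Poly_Mapping.lookup m y) P) \<noteq> 0"
      using S vars mpoly_slice_neq_0[OF m] unfolding alg_independent_def by blast
    then have "?q \<noteq> 0"
      by (metis coeff_mpoly_to_poly coeff_0)
    moreover have "poly.coeff ?q i \<in> base_closure S" for i
      unfolding coeff_mpoly_to_poly by (rule eval_in_base_closure[OF vars])
    moreover have "poly ?q y = 0"
      by (simp add: poly_mpoly_to_poly P(2))
    ultimately show ?thesis
      unfolding alg_closure_in_def algebraic_over_def by blast
  qed
  moreover have "\<not> alg_independent \<phi> (insert y S)" if dep: "y \<in> alg_closure_in S"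
  proof -
    interpret H: mpoly_eval_hom "\<lambda>c. [:\<phi> c:]" by (rule hom_poly)
    obtain q where q: "q \<noteq> 0" "\<And>i. poly.coeff q i \<in> base_closure S" "poly q y = 0"
      using dep unfolding alg_closure_in_def algebraic_over_def by blast
    have "\<exists>U V. mpoly_vars U \<subseteq> S \<and> mpoly_vars V \<subseteq> S \<and> ?ev V \<noteq> 0 \<and> poly.coeff q i = ?ev U / ?ev V" for i
      using base_closure_fraction[OF q(2)[of i]] by metis
    then obtain U V where UV: "\<And>i. mpoly_vars (U i) \<subseteq> S" "\<And>i. mpoly_vars (V i) \<subseteq> S"
      "\<And>i. ?ev (V i) \<noteq> 0" "\<And>i. poly.coeff q i = ?ev (U i) / ?ev (V i)"
      by metis
    \<comment> \<open>The \<open>i\<close>-th coefficient of \<open>q\<close> is the value of \<open>C i\<close> divided by the common denominator \<open>d\<close>.\<close>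
    let ?I = "{..degree q}"
    define d where "d = (\<Prod>i\<in>?I. ?ev (V i))"
    define C where "C i = U i * (\<Prod>j\<in>?I - {i}. V j)" for i
    define P where "P = (\<Sum>i\<in>?I. C i * mpoly_var y ^ i)"
    have C: "mpoly_vars (C i) \<subseteq> S" for i
      unfolding C_def using UV(1,2) by (intro mpoly_vars_mult_le mpoly_vars_prod_le)
    have "?ev (C i) = d * poly.coeff q i" if "i \<in> ?I" for i
      using that UV(3,4)[of i] unfolding C_def d_def eval_mult eval_prod
      by (subst (2) prod.remove[of _ i]) auto
    moreover have "mpoly_to_poly \<phi> y (mpoly_var y ^ i) = Polynomial.monom 1 i" for i
      unfolding mpoly_to_poly_def by (simp add: H.eval_power H.eval_var monom_altdef)
    moreover have "mpoly_to_poly \<phi> y (C i) = [:?ev (C i):]" for i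
      using C y by (intro mpoly_to_poly_no_var) auto
    ultimately have "mpoly_to_poly \<phi> y P = (\<Sum>i\<in>?I. smult d (Polynomial.monom (poly.coeff q i) i))"
      unfolding P_def mpoly_to_poly_def H.eval_sum H.eval_mult
      by (intro sum.cong) (simp_all add: smult_monom)
    also have "\<dots> = smult d q"
      by (intro poly_eqI) (simp add: coeff_sum sum.delta coeff_eq_0 not_le flip: sum_distrib_left)
    finally have eq: "mpoly_to_poly \<phi> y P = smult d q" .
    \<comment> \<open>The relation \<open>P\<close> is nonzero because already its image in one variable is.\<close>
    have "d \<noteq> 0" unfolding d_def using UV(3) by simp
    then have "P \<noteq> 0"
      using eq q(1) by (auto simp: mpoly_to_poly_def H.eval_zero)
    moreover have "?ev P = 0"
      using arg_cong[OF eq, of "\<lambda>q. poly q y"] q(3) by (simp add: poly_mpoly_to_poly)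
    moreover have "mpoly_vars P \<subseteq> insert y S"
      unfolding P_def
      by (intro mpoly_vars_sum_le mpoly_vars_mult_le order_trans[OF C] order_trans[OF mpoly_vars_power_var]) auto
    ultimately show ?thesis
      unfolding alg_independent_def by blast
  qed
  ultimately show ?thesis by blast
qed

text \<open>
  Steinitz exchange. Some element \<open>t\<close> of \<open>T\<close> outside \<open>S\<close> can be replaced by an element of \<open>S\<close>: if all of
  \<open>S\<close> were algebraic over the rest of \<open>T\<close>, then so would be \<open>t\<close>. Each exchange makes
  \<open>T - S\<close> smaller.
\<close>
lemma alg_independent_card_le:
  assumes "finite S" "finite T" "alg_independent \<phi> T" "T \<subseteq> alg_closure_in S"
  shows "card T \<le> card S"
  using assms(2-)
proof (induction "card (T - S)" arbitrary: T rule: less_induct)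
  case less
  show ?case
  proof (cases "T \<subseteq> S")
    case True
    then show ?thesis using assms(1) by (rule card_mono[rotated])
  next
    case False
    then obtain t where t: "t \<in> T" "t \<notin> S" by blast
    let ?T = "T - {t}"
    have indep: "alg_independent \<phi> ?T"
      using less.prems(2) by (rule alg_independent_mono) auto
    have "alg_independent \<phi> (insert t ?T)"
      using less.prems(2) t(1) by (simp add: insert_absorb)
    then have "t \<notin> alg_closure_in ?T"
      using alg_independent_insert[OF indep, of t] by simp
    then have "\<not> S \<subseteq> alg_closure_in ?T"
      using alg_closure_in_le[of S ?T] less.prems(3) t(1) by blast
    then obtain s where s: "s \<in> S" "s \<notin> alg_closure_in ?T" by blast
    have "s \<notin> ?T" using s(2) subset_alg_closure_in[of ?T] by blast
    then have "alg_independent \<phi> (insert s ?T)"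
      using alg_independent_insert[OF indep, of s] s(2) by simp
    moreover have "insert s ?T \<subseteq> alg_closure_in S"
      using less.prems(3) s(1) subset_alg_closure_in[of S] by blast
    moreover have "card (insert s ?T - S) < card (T - S)"
    proof -
      have "insert s ?T - S = T - S - {t}"
        using s(1) by auto
      then show ?thesis
        using t less.prems(1) by (metis DiffI card_Diff1_less finite_Diff)
    qed
    ultimately have "card (insert s ?T) \<le> card S"
      using less.hyps[of "insert s ?T"] less.prems(1) by simp
    moreover have "card (insert s ?T) = card T"
      using \<open>s \<notin> ?T\<close> less.prems(1) t(1) card_Suc_Diff1[of T t] by simp
    ultimately show ?thesis by simp
  qed
qed

text \<open>
  If every independent subset of \<open>A\<close> were smaller than \<open>T\<close>, a largest one would exist. All of \<open>A\<close>, hence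
  the whole generated field, would be algebraic over it, contradicting the exchange lemma.
\<close>
lemma alg_independent_generators:
  assumes "finite T" "alg_independent \<phi> T" "T \<subseteq> base_closure A"
  shows "\<exists>S. S \<subseteq> A \<and> finite S \<and> alg_independent \<phi> S \<and> card T \<le> card S"
proof (rule ccontr)
  assume no: "\<not> ?thesis"
  let ?P = "\<lambda>S. S \<subseteq> A \<and> finite S \<and> alg_independent \<phi> S"
  have lt: "card S < card T" if "?P S" for S
    using that no not_less by blast
  have "?P {}" by (simp add: alg_independent_empty)
  then obtain S where S: "?P S" and max: "\<And>S'. ?P S' \<Longrightarrow> card S' \<le> card S"
    using ex_has_greatest_nat[of ?P "{}" card "card T"] lt by blast
  have "y \<in> alg_closure_in S" if "y \<in> A" for y
  proof (rule ccontr)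
    assume y: "y \<notin> alg_closure_in S"
    then have "y \<notin> S" using subset_alg_closure_in[of S] by blast
    with y S have "alg_independent \<phi> (insert y S)"
      using alg_independent_insert[of S y] by simp
    then have "card (insert y S) \<le> card S"
      using S that by (intro max) auto
    with \<open>y \<notin> S\<close> S show False by simp
  qed
  then have "base_closure A \<subseteq> alg_closure_in S"
    using base_closure_ge(1)[of S] base_closure_subset_alg_closure_in[of S]
    by (intro base_closure_le subfield_alg_closure_in) auto
  then have "card T \<le> card S"
    using S assms by (intro alg_independent_card_le) auto
  with lt[OF S] show False by simp
qed

lemma trdeg_base_closure_le: "trdeg \<phi> (base_closure A) \<le> trdeg \<phi> A"
  unfolding trdeg_def
proof (rule SUP_mono)
  fix T assume "T \<in> {T. T \<subseteq> base_closure A \<and> finite T \<and> alg_independent \<phi> T}"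
  then obtain S where "S \<subseteq> A" "finite S" "alg_independent \<phi> S" "card T \<le> card S"
    using alg_independent_generators[of T A] by auto
  then show "\<exists>S\<in>{S. S \<subseteq> A \<and> finite S \<and> alg_independent \<phi> S}. enat (card T) \<le> enat (card S)"
    by auto
qed

end

section \<open>Places and their Gauss extension\<close>

text \<open>
  A homomorphism that is defined on a subring only is represented by its graph, a subring of the
  product. This avoids values outside the domain, and the extensions of the homomorphism to
  polynomials and to fractions become sets of pairs whose closure properties are immediate.
\<close>
locale ring_rel =
  fixes R :: "('a::comm_ring_1 \<times> 'b::comm_ring_1) set"
  assumes one: "(1, 1) \<in> R"
    and diff: "(a, b) \<in> R \<Longrightarrow> (c, d) \<in> R \<Longrightarrow> (a - c, b - d) \<in> R"
    and mult: "(a, b) \<in> R \<Longrightarrow> (c, d) \<in> R \<Longrightarrow> (a * c, b * d) \<in> R"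
begin

lemma zero: "(0, 0) \<in> R"
  using diff[OF one one] by simp

lemma uminus: "(a, b) \<in> R \<Longrightarrow> (- a, - b) \<in> R"
  using diff[OF zero] by simp

lemma add: "(a, b) \<in> R \<Longrightarrow> (c, d) \<in> R \<Longrightarrow> (a + c, b + d) \<in> R"
  using diff[of a b "- c" "- d"] uminus[of c d] by simp

lemma power: "(a, b) \<in> R \<Longrightarrow> (a ^ n, b ^ n) \<in> R"
  by (induction n) (simp_all add: one mult)

lemma sum: "(\<And>i. i \<in> I \<Longrightarrow> (f i, g i) \<in> R) \<Longrightarrow> (sum f I, sum g I) \<in> R"
  by (induction I rule: infinite_finite_induct) (simp_all add: zero add)

lemma prod: "(\<And>i. i \<in> I \<Longrightarrow> (f i, g i) \<in> R) \<Longrightarrow> (prod f I, prod g I) \<in> R"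
  by (induction I rule: infinite_finite_induct) (simp_all add: one mult)

end

definition mpoly_rel :: "('a::comm_ring_1 \<times> 'b::comm_ring_1) set \<Rightarrow> (('x, 'a) mpoly \<times> ('x, 'b) mpoly) set" where
  "mpoly_rel R = {(P, Q). \<forall>m. (Poly_Mapping.lookup P m, Poly_Mapping.lookup Q m) \<in> R}"

lemma mpoly_relI: "(\<And>m. (Poly_Mapping.lookup P m, Poly_Mapping.lookup Q m) \<in> R) \<Longrightarrow> (P, Q) \<in> mpoly_rel R"
  by (simp add: mpoly_rel_def)

lemma mpoly_relD: "(P, Q) \<in> mpoly_rel R \<Longrightarrow> (Poly_Mapping.lookup P m, Poly_Mapping.lookup Q m) \<in> R"
  by (simp add: mpoly_rel_def)

lemma sum_singles_superset:
  assumes "finite A" "Poly_Mapping.keys P \<subseteq> A"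
  shows "P = (\<Sum>m\<in>A. Poly_Mapping.single m (Poly_Mapping.lookup P m))"
proof (rule poly_mapping_eqI)
  fix k
  have "Poly_Mapping.lookup (\<Sum>m\<in>A. Poly_Mapping.single m (Poly_Mapping.lookup P m)) k
    = (\<Sum>m\<in>A. if m = k then Poly_Mapping.lookup P k else 0)"
    unfolding lookup_sum by (rule sum.cong) (simp_all add: lookup_single when_def)
  also have "\<dots> = Poly_Mapping.lookup P k"
    using assms by (auto simp: sum.delta not_in_keys_iff_lookup_eq_zero)
  finally show "Poly_Mapping.lookup P k
    = Poly_Mapping.lookup (\<Sum>m\<in>A. Poly_Mapping.single m (Poly_Mapping.lookup P m)) k" ..
qed

lemma mpoly_eval_superset:
  assumes "finite A" "Poly_Mapping.keys P \<subseteq> A" "\<phi> 0 = 0"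
  shows "mpoly_eval \<phi> v P = (\<Sum>m\<in>A. \<phi> (Poly_Mapping.lookup P m) *
    (\<Prod>x\<in>Poly_Mapping.keys m. v x ^ Poly_Mapping.lookup m x))"
  unfolding mpoly_eval_def
  by (rule sum.mono_neutral_left) (use assms in \<open>auto simp: not_in_keys_iff_lookup_eq_zero\<close>)

context ring_rel
begin

lemma single: "(a, b) \<in> R \<Longrightarrow> (Poly_Mapping.single m a, Poly_Mapping.single m b) \<in> mpoly_rel R"
  by (rule mpoly_relI) (simp add: lookup_single when_def zero)

lemma const: "(a, b) \<in> R \<Longrightarrow> (mpoly_const a, mpoly_const b) \<in> mpoly_rel R"
  unfolding mpoly_const_def by (rule single)

lemma var: "(mpoly_var x, mpoly_var x) \<in> mpoly_rel R"
  unfolding mpoly_var_def by (rule single) (rule one)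

lemma mpoly_rel_sum:
  assumes "\<And>i. i \<in> I \<Longrightarrow> (f i, g i) \<in> mpoly_rel R"
  shows "(sum f I, sum g I) \<in> mpoly_rel R"
  by (rule mpoly_relI) (use assms in \<open>auto simp: lookup_sum intro!: sum dest: mpoly_relD\<close>)

lemma ring_rel_mpoly_rel: "ring_rel (mpoly_rel R :: (('x, 'a) mpoly \<times> ('x, 'b) mpoly) set)"
proof
  show "(1 :: ('x, 'a) mpoly, 1 :: ('x, 'b) mpoly) \<in> mpoly_rel R"
    using const[OF one] by (simp add: mpoly_const_def)
next
  fix P P' :: "('x, 'a) mpoly" and Q Q' :: "('x, 'b) mpoly"
  assume PQ: "(P, Q) \<in> mpoly_rel R" "(P', Q') \<in> mpoly_rel R"
  show "(P - P', Q - Q') \<in> mpoly_rel R"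
    using PQ by (auto intro!: mpoly_relI diff dest: mpoly_relD simp: lookup_minus)
  let ?A = "Poly_Mapping.keys P \<union> Poly_Mapping.keys Q"
  let ?B = "Poly_Mapping.keys P' \<union> Poly_Mapping.keys Q'"
  have "((\<Sum>m\<in>?A. Poly_Mapping.single m (Poly_Mapping.lookup P m)) *
         (\<Sum>m\<in>?B. Poly_Mapping.single m (Poly_Mapping.lookup P' m)),
         (\<Sum>m\<in>?A. Poly_Mapping.single m (Poly_Mapping.lookup Q m)) *
         (\<Sum>m\<in>?B. Poly_Mapping.single m (Poly_Mapping.lookup Q' m))) \<in> mpoly_rel R"
    unfolding sum_product mult_single
    by (intro mpoly_rel_sum single mult mpoly_relD[OF PQ(1)] mpoly_relD[OF PQ(2)])
  then show "(P * P', Q * Q') \<in> mpoly_rel R"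
    by (simp flip: sum_singles_superset)
qed

text \<open>
  Evaluation uses ring operations only, so it commutes with reduction as soon as the constants and
  the values of the variables do.
\<close>
lemma mpoly_eval_rel:
  assumes "ring_rel S" "(P, Q) \<in> mpoly_rel R"
    and "\<And>a b. (a, b) \<in> R \<Longrightarrow> (\<phi> a, \<psi> b) \<in> S" "\<phi> 0 = 0" "\<psi> 0 = 0"
    and v: "\<And>x. x \<in> mpoly_vars P \<union> mpoly_vars Q \<Longrightarrow> (v x, w x) \<in> S"
  shows "(mpoly_eval \<phi> v P, mpoly_eval \<psi> w Q) \<in> S"
proof -
  interpret S: ring_rel S by fact
  let ?A = "Poly_Mapping.keys P \<union> Poly_Mapping.keys Q"
  have P: "mpoly_eval \<phi> v P = (\<Sum>m\<in>?A. \<phi> (Poly_Mapping.lookup P m) *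
      (\<Prod>x\<in>Poly_Mapping.keys m. v x ^ Poly_Mapping.lookup m x))"
    using assms by (intro mpoly_eval_superset) auto
  have Q: "mpoly_eval \<psi> w Q = (\<Sum>m\<in>?A. \<psi> (Poly_Mapping.lookup Q m) *
      (\<Prod>x\<in>Poly_Mapping.keys m. w x ^ Poly_Mapping.lookup m x))"
    using assms by (intro mpoly_eval_superset) auto
  show ?thesis
    unfolding P Q
    by (intro S.sum S.mult S.prod S.power v assms(3) mpoly_relD[OF assms(2)])
       (auto simp: mpoly_vars_def)
qed

end

text \<open>
  The second assumption says that the domain is a valuation ring and that the homomorphism kills
  its maximal ideal. At the elements outside the domain the place is infinite.
\<close>
locale place = ring_rel R for R :: "('a::field \<times> 'b::field) set" +
  assumes functional: "(0, b) \<in> R \<Longrightarrow> b = 0"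
    and total: "a \<notin> Domain R \<Longrightarrow> (inverse a, 0) \<in> R"
begin

lemma mpoly_rel_functional:
  assumes "(P, Q) \<in> mpoly_rel R"
  shows "Poly_Mapping.keys Q \<subseteq> Poly_Mapping.keys P"
proof
  fix m assume "m \<in> Poly_Mapping.keys Q"
  moreover have "Poly_Mapping.lookup Q m = 0" if "Poly_Mapping.lookup P m = 0"
    using mpoly_relD[OF assms, of m] that functional by simp
  ultimately show "m \<in> Poly_Mapping.keys P"
    unfolding in_keys_iff by blast
qed

lemma mpoly_rel_0: "(0, Q) \<in> mpoly_rel R \<Longrightarrow> Q = 0"
  using mpoly_rel_functional[of 0 Q] by simp

lemma mpoly_rel_vars: "(P, Q) \<in> mpoly_rel R \<Longrightarrow> mpoly_vars Q \<subseteq> mpoly_vars P"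
  using mpoly_rel_functional[of P Q] unfolding mpoly_vars_def by blast

text \<open>Divisibility in a valuation ring is total, so a finite set has an element of least valuation.\<close>
lemma exists_dominating:
  assumes "finite A" "A \<noteq> {}" "0 \<notin> A"
  shows "\<exists>a\<in>A. \<forall>b\<in>A. b / a \<in> Domain R"
  using assms
proof (induction A rule: finite_ne_induct)
  case (singleton x)
  then show ?case using one by (auto intro: DomainI)
next
  case (insert x A)
  then obtain a where a: "a \<in> A" "\<And>b. b \<in> A \<Longrightarrow> b / a \<in> Domain R" by auto
  have "x \<noteq> 0" "a \<noteq> 0" using a insert.prems by auto
  show ?case
  proof (cases "x / a \<in> Domain R")
    case True
    then show ?thesis using a by blast
  next
    case False
    then have x: "(a / x, 0) \<in> R" using total[of "x / a"] by simp
    have "b / x \<in> Domain R" if b: "b \<in> A" for b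
    proof -
      obtain r where "(b / a, r) \<in> R" using a(2)[OF b] by blast
      then have "(b / a * (a / x), r * 0) \<in> R" by (rule mult[OF _ x])
      then show ?thesis using \<open>a \<noteq> 0\<close> by auto
    qed
    moreover have "x / x \<in> Domain R" using \<open>x \<noteq> 0\<close> one by auto
    ultimately show ?thesis by blast
  qed
qed

text \<open>
  Dividing by a coefficient of least valuation makes all coefficients integral and one of them
  equal to \<open>1\<close>.
\<close>
lemma exists_primitive_multiple:
  fixes P :: "('x, 'a) mpoly"
  assumes "P \<noteq> 0"
  obtains c and Q :: "('x, 'b) mpoly" where "c \<noteq> 0" "Q \<noteq> 0" "(mpoly_const c * P, Q) \<in> mpoly_rel R"
proof -
  have "finite (Poly_Mapping.lookup P ` Poly_Mapping.keys P)"
    "Poly_Mapping.lookup P ` Poly_Mapping.keys P \<noteq> {}" "0 \<notin> Poly_Mapping.lookup P ` Poly_Mapping.keys P"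
    using assms by (auto dest: sym)
  then obtain m0 where m0: "m0 \<in> Poly_Mapping.keys P"
    "\<And>m. m \<in> Poly_Mapping.keys P \<Longrightarrow> Poly_Mapping.lookup P m / Poly_Mapping.lookup P m0 \<in> Domain R"
    using exists_dominating by (metis (no_types, lifting) image_iff)
  define a where "a = Poly_Mapping.lookup P m0"
  have "a \<noteq> 0" using m0(1) unfolding a_def in_keys_iff .
  define r where "r z = (SOME w. (z, w) \<in> R)" for z
  have r: "(z, r z) \<in> R" if "z \<in> Domain R" for z
    unfolding r_def using that by (metis DomainE someI_ex)
  define Q where "Q = Poly_Mapping.map r (mpoly_const (inverse a) * P)"
  have lookup: "Poly_Mapping.lookup (mpoly_const c * P) m = c * Poly_Mapping.lookup P m" for c m
    unfolding mpoly_const_def mult_map_scale_conv_mult[symmetric] by (simp add: map.rep_eq when_def)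
  have rel: "(mpoly_const (inverse a) * P, Q) \<in> mpoly_rel R"
  proof (rule mpoly_relI)
    fix m
    show "(Poly_Mapping.lookup (mpoly_const (inverse a) * P) m, Poly_Mapping.lookup Q m) \<in> R"
    proof (cases "Poly_Mapping.lookup P m = 0")
      case True
      then show ?thesis by (simp add: Q_def map.rep_eq lookup zero when_def)
    next
      case False
      then have "m \<in> Poly_Mapping.keys P" unfolding in_keys_iff .
      then have "inverse a * Poly_Mapping.lookup P m \<in> Domain R"
        using m0(2)[of m] unfolding a_def[symmetric] by (simp add: field_class.field_divide_inverse mult.commute)
      then show ?thesis using r False \<open>a \<noteq> 0\<close> by (simp add: Q_def map.rep_eq lookup when_def)
    qed
  qed
  have "(1, Poly_Mapping.lookup Q m0) \<in> R"
    using mpoly_relD[OF rel, of m0] \<open>a \<noteq> 0\<close> unfolding lookup a_def[symmetric] by simp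
  from diff[OF one this] have "Poly_Mapping.lookup Q m0 = 1"
    using functional by force
  then have "Q \<noteq> 0" by auto
  with rel \<open>a \<noteq> 0\<close> show thesis by (intro that[of "inverse a" Q]) auto
qed

end

lemma field_hom_ratfun_const: "field_hom (ratfun_const :: 'a::field \<Rightarrow> ('g, 'a) ratfun)"
  by unfold_locales
     (simp_all add: ratfun_const_def mpoly_const.zero mpoly_const.one mpoly_const.add mpoly_const.mult
       Zero_fract_def One_fract_def)

interpretation ratfun_const: field_hom ratfun_const
  by (rule field_hom_ratfun_const)

text \<open>The Gauss extension: fractions of integral polynomials whose denominator does not reduce to zero.\<close>
definition ratfun_rel :: "('a::field \<times> 'b::field) set \<Rightarrow> (('g, 'a) ratfun \<times> ('g, 'b) ratfun) set" where
  "ratfun_rel R = {(Fract a b, Fract a' b') | a b a' b'.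
     (a, a') \<in> mpoly_rel R \<and> (b, b') \<in> mpoly_rel R \<and> b' \<noteq> 0}"

context place
begin

lemma ratfun_relI:
  "(a, a') \<in> mpoly_rel R \<Longrightarrow> (b, b') \<in> mpoly_rel R \<Longrightarrow> b' \<noteq> 0 \<Longrightarrow> (Fract a b, Fract a' b') \<in> ratfun_rel R"
  unfolding ratfun_rel_def by blast

lemma ratfun_relE:
  assumes "(z, z') \<in> ratfun_rel R"
  obtains a a' b b' where "z = Fract a b" "z' = Fract a' b'" "(a, a') \<in> mpoly_rel R"
    "(b, b') \<in> mpoly_rel R" "b' \<noteq> 0" "b \<noteq> 0"
proof -
  from assms obtain a a' b b' where *: "z = Fract a b" "z' = Fract a' b'" "(a, a') \<in> mpoly_rel R"
    "(b, b') \<in> mpoly_rel R" "b' \<noteq> 0"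
    unfolding ratfun_rel_def by blast
  moreover have "b \<noteq> 0" using * mpoly_rel_0 by blast
  ultimately show thesis by (rule that)
qed

lemma ring_rel_ratfun_rel: "ring_rel (ratfun_rel R :: (('g, 'a) ratfun \<times> ('g, 'b) ratfun) set)"
proof
  interpret M: ring_rel "mpoly_rel R :: (('g var, 'a) mpoly \<times> ('g var, 'b) mpoly) set"
    by (rule ring_rel_mpoly_rel)
  show "(1 :: ('g, 'a) ratfun, 1 :: ('g, 'b) ratfun) \<in> ratfun_rel R"
    unfolding One_fract_def by (intro ratfun_relI M.one) simp
  fix z w :: "('g, 'a) ratfun" and z' w' :: "('g, 'b) ratfun"
  assume "(z, z') \<in> ratfun_rel R" "(w, w') \<in> ratfun_rel R"
  then obtain a a' b b' c c' d d' where *: "z = Fract a b" "z' = Fract a' b'" "w = Fract c d" "w' = Fract c' d'"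
    and rel: "(a, a') \<in> mpoly_rel R" "(b, b') \<in> mpoly_rel R" "(c, c') \<in> mpoly_rel R" "(d, d') \<in> mpoly_rel R"
    and nz: "b \<noteq> 0" "b' \<noteq> 0" "d \<noteq> 0" "d' \<noteq> 0"
    by (metis ratfun_relE)
  have "(Fract (a * d - c * b) (b * d), Fract (a' * d' - c' * b') (b' * d')) \<in> ratfun_rel R"
    by (intro ratfun_relI M.diff M.mult rel) (simp add: nz)
  then show "(z - w, z' - w') \<in> ratfun_rel R"
    unfolding * using nz by simp
  have "(Fract (a * c) (b * d), Fract (a' * c') (b' * d')) \<in> ratfun_rel R"
    by (intro ratfun_relI M.mult rel) (simp add: nz)
  then show "(z * w, z' * w') \<in> ratfun_rel R"
    unfolding * by simp
qed

lemma ratfun_rel_functional: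
  assumes "(0, z) \<in> ratfun_rel R"
  shows "z = 0"
proof -
  obtain a a' b b' where *: "0 = Fract a b" "z = Fract a' b'" "(a, a') \<in> mpoly_rel R" "b \<noteq> 0" "b' \<noteq> 0"
    using assms by (rule ratfun_relE)
  then have "a = 0" by (simp add: Zero_fract_def eq_fract)
  then have "a' = 0" using * mpoly_rel_0 by blast
  then show ?thesis using * by (simp add: Zero_fract_def eq_fract)
qed

lemma ratfun_rel_unique: "(z, u) \<in> ratfun_rel R \<Longrightarrow> (z, w) \<in> ratfun_rel R \<Longrightarrow> u = w"
  using ring_rel.diff[OF ring_rel_ratfun_rel, of z u z w] ratfun_rel_functional[of "u - w"] by simp

lemma ratfun_rel_const: "(a, b) \<in> R \<Longrightarrow> (ratfun_const a, ratfun_const b) \<in> ratfun_rel R"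
  unfolding ratfun_const_def
  by (intro ratfun_relI const ring_rel.one[OF ring_rel_mpoly_rel]) auto

text \<open>
  The Gauss extension has the same value group as the place: numerator and denominator are made
  primitive separately.
\<close>
lemma exists_unit_multiple:
  fixes a b :: "('g var, 'a) mpoly"
  assumes "a \<noteq> 0" "b \<noteq> 0"
  obtains c and a' b' :: "('g var, 'b) mpoly" where "c \<noteq> 0" "a' \<noteq> 0" "b' \<noteq> 0" "mpoly_vars a' \<subseteq> mpoly_vars a" "mpoly_vars b' \<subseteq> mpoly_vars b"
    "(ratfun_const c * Fract a b, Fract a' b') \<in> ratfun_rel R"
proof -
  obtain c and a' :: "('g var, 'b) mpoly" where a: "c \<noteq> 0" "a' \<noteq> 0" "(mpoly_const c * a, a') \<in> mpoly_rel R"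
    using exists_primitive_multiple[OF assms(1)] by blast
  obtain d and b' :: "('g var, 'b) mpoly" where b: "d \<noteq> 0" "b' \<noteq> 0" "(mpoly_const d * b, b') \<in> mpoly_rel R"
    using exists_primitive_multiple[OF assms(2)] by blast
  have "(ratfun_const (c / d) :: ('g, 'a) ratfun) = Fract (mpoly_const c) (mpoly_const d)"
  proof -
    have "(ratfun_const (c / d) :: ('g, 'a) ratfun) = ratfun_const c / ratfun_const d"
      by (simp add: field_class.field_divide_inverse ratfun_const.mult ratfun_const.inverse)
    then show ?thesis by (simp add: ratfun_const_def)
  qed
  then have "(ratfun_const (c / d) * Fract a b, Fract a' b') \<in> ratfun_rel R"
    using ratfun_relI[OF a(3) b(3,2)] by simp
  moreover have "mpoly_vars a' \<subseteq> mpoly_vars a"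
    using mpoly_rel_vars[OF a(3)] mpoly_vars_mult[of "mpoly_const c" a] by simp
  moreover have "mpoly_vars b' \<subseteq> mpoly_vars b"
    using mpoly_rel_vars[OF b(3)] mpoly_vars_mult[of "mpoly_const d" b] by simp
  ultimately show thesis
    using a b by (intro that[of "c / d" a' b']) auto
qed

lemma ratfun_rel_rename:
  assumes "inj f" "(z, z') \<in> ratfun_rel R"
  shows "(ratfun_rename f z, ratfun_rename f z') \<in> ratfun_rel R"
proof -
  have inj: "inj (map_var f)" using assms(1) by (rule var.inj_map)
  obtain a a' b b' where *: "z = Fract a b" "z' = Fract a' b'" "(a, a') \<in> mpoly_rel R"
    "(b, b') \<in> mpoly_rel R" "b' \<noteq> 0" "b \<noteq> 0"
    using assms(2) by (rule ratfun_relE)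
  have rel: "(mpoly_rename (map_var f) P, mpoly_rename (map_var f) Q) \<in> mpoly_rel R"
    if "(P, Q) \<in> mpoly_rel R" for P :: "('c var, 'a) mpoly" and Q :: "('c var, 'b) mpoly"
    unfolding mpoly_rename_def
    by (rule mpoly_eval_rel[OF ring_rel_mpoly_rel that]) (auto intro: const var simp: mpoly_const.zero)
  show ?thesis
    unfolding *(1,2) ratfun_rename_Fract[OF assms(1) *(5)] ratfun_rename_Fract[OF assms(1) *(6)]
    by (intro ratfun_relI rel *(3,4)) (simp add: mpoly_rename_eq_0_iff[OF inj] *(5))
qed

end

section \<open>The regular representation under reduction\<close>

lemma Fract_mem_subfield:
  fixes F :: "('g, 'a::field) ratfun set"
  assumes F: "subfield F ring_of_type_algebra" and const: "range ratfun_const \<subseteq> F"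
    and var: "\<And>x. x \<in> mpoly_vars P \<union> mpoly_vars Q \<Longrightarrow> ratfun_var (index x) \<in> F"
  shows "Fract P Q \<in> F"
proof -
  interpret F: type_subfield F using F by (rule type_subfield.intro)
  have mem: "Fract P 1 \<in> F" if "\<And>x. x \<in> mpoly_vars P \<Longrightarrow> ratfun_var (index x) \<in> F" for P :: "('g var, 'a) mpoly"
  proof -
    have add: "Fract (a + b) 1 = Fract a 1 + Fract b 1"
      and mult: "Fract (a * b) 1 = Fract a 1 * Fract b 1" for a b :: "('g var, 'a) mpoly"
      by simp_all
    have sum: "Fract (sum f I) 1 = (\<Sum>i\<in>I. Fract (f i) 1)" for f :: "('g var \<Rightarrow>\<^sub>0 nat) \<Rightarrow> ('g var, 'a) mpoly" and I
      by (induction I rule: infinite_finite_induct) (simp_all add: fract_collapse add del: add_fract)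
    have prod: "Fract (prod f I) 1 = (\<Prod>i\<in>I. Fract (f i) 1)" for f :: "'g var \<Rightarrow> ('g var, 'a) mpoly" and I
      by (induction I rule: infinite_finite_induct) (simp_all add: fract_collapse mult del: mult_fract)
    have power: "Fract (a ^ n) 1 = Fract a 1 ^ n" for a :: "('g var, 'a) mpoly" and n
      by (induction n) (simp_all add: fract_collapse mult del: mult_fract)
    have vars: "Fract (mpoly_var x) 1 = ratfun_var (index x)" for x :: "'g var"
      by (simp add: ratfun_var_def)
    have "Fract P 1 = Fract (\<Sum>m\<in>Poly_Mapping.keys P. Poly_Mapping.single m (Poly_Mapping.lookup P m)) 1"
      by (subst sum_singles_superset[of "Poly_Mapping.keys P" P]) simp_all
    also have "\<dots> = (\<Sum>m\<in>Poly_Mapping.keys P. ratfun_const (Poly_Mapping.lookup P m) *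
        (\<Prod>x\<in>Poly_Mapping.keys m. ratfun_var (index x) ^ Poly_Mapping.lookup m x))"
      unfolding sum single_eq_prod mult prod power vars ratfun_const_def ..
    also have "\<dots> \<in> F"
      using that const by (intro F.sum F.mult F.prod F.power) (auto simp: mpoly_vars_def)
    finally show ?thesis .
  qed
  have "Fract P Q = Fract P 1 / Fract Q 1" by simp
  also have "\<dots> \<in> F" by (intro F.divide mem var) auto
  finally show ?thesis .
qed

lemma regrep_field_Fract:
  fixes z :: "('g, 'a::field) ratfun"
  assumes "z \<in> regrep_field G"
  obtains a b where "z = Fract a b" "b \<noteq> 0" "mpoly_vars a \<subseteq> Var ` carrier G" "mpoly_vars b \<subseteq> Var ` carrier G"
proof -
  let ?V = "Var ` carrier G"
  let ?Q = "{Fract a b | a b. b \<noteq> 0 \<and> mpoly_vars a \<subseteq> ?V \<and> mpoly_vars b \<subseteq> ?V} :: ('g, 'a) ratfun set"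
  have memI: "w \<in> ?Q" if "w = Fract a b" "b \<noteq> 0" "mpoly_vars a \<subseteq> ?V" "mpoly_vars b \<subseteq> ?V" for w a b
    using that by blast
  have "subfield ?Q ring_of_type_algebra"
    unfolding subfield_type_iff
  proof (intro conjI ballI)
    show "1 \<in> ?Q" by (rule memI[of _ 1 1]) (simp_all add: One_fract_def)
  next
    fix x y assume "x \<in> ?Q" "y \<in> ?Q"
    then obtain a b c d where *: "x = Fract a b" "b \<noteq> 0" "mpoly_vars a \<subseteq> ?V" "mpoly_vars b \<subseteq> ?V"
      "y = Fract c d" "d \<noteq> 0" "mpoly_vars c \<subseteq> ?V" "mpoly_vars d \<subseteq> ?V" by blast
    show "x - y \<in> ?Q"
      by (rule memI[of _ "a * d - c * b" "b * d"])
         (simp_all add: * mpoly_vars_diff_le mpoly_vars_mult_le)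
    show "x * y \<in> ?Q"
      by (rule memI[of _ "a * c" "b * d"]) (simp_all add: * mpoly_vars_mult_le)
  next
    fix x assume "x \<in> ?Q"
    then obtain a b where *: "x = Fract a b" "b \<noteq> 0" "mpoly_vars a \<subseteq> ?V" "mpoly_vars b \<subseteq> ?V" by blast
    show "inverse x \<in> ?Q"
    proof (cases "a = 0")
      case True
      then have "inverse x = Fract 0 1" by (simp add: * fract_collapse)
      then show ?thesis by (rule memI) simp_all
    next
      case False
      then show ?thesis using * by (intro memI[of _ b a]) simp_all
    qed
  qed
  moreover have "range ratfun_const \<union> ratfun_var ` carrier G \<subseteq> ?Q"
  proof
    fix w :: "('g, 'a) ratfun" assume "w \<in> range ratfun_const \<union> ratfun_var ` carrier G"
    then consider c where "w = Fract (mpoly_const c) 1" | g where "g \<in> carrier G" "w = Fract (mpoly_var (Var g)) 1"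
      by (auto simp: ratfun_const_def ratfun_var_def)
    then show "w \<in> ?Q"
    proof cases
      case 1 then show ?thesis by (rule memI) simp_all
    next
      case 2 then show ?thesis by (intro memI[of w "mpoly_var (Var g)" 1]) simp_all
    qed
  qed
  ultimately have "regrep_field G \<subseteq> ?Q"
    unfolding regrep_field_def by (rule generate_field_le)
  with assms have "z \<in> ?Q" by blast
  then show thesis using that by blast
qed

lemma ratfun_var_mem_regrep_field: "g \<in> carrier G \<Longrightarrow> ratfun_var g \<in> regrep_field G"
  and ratfun_const_mem_regrep_field: "ratfun_const c \<in> regrep_field G"
  unfolding regrep_field_def by (auto intro: generate_field.incl)

lemma subfield_regrep_field: "subfield (regrep_field G) ring_of_type_algebra"
  unfolding regrep_field_def by (rule subfield_generate_field)

text \<open>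
  Only a fraction whose numerator and denominator are primitive is guaranteed to reduce to a
  fraction in the same variables. Such a fraction is a constant multiple \<open>c z\<close>, and \<open>c\<close> cannot have
  positive valuation, for then \<open>c z\<close> would reduce to zero.
\<close>
lemma (in place) regrep_field_reduction:
  fixes z :: "('g, 'a) ratfun" and z' :: "('g, 'b) ratfun"
  assumes z: "z \<in> regrep_field G" and rel: "(z, z') \<in> ratfun_rel R"
  shows "z' \<in> regrep_field G"
proof (cases "z = 0")
  case True
  then have "z' = ratfun_const 0" using rel ratfun_rel_functional ratfun_const.zero by metis
  then show ?thesis using ratfun_const_mem_regrep_field by metis
next
  case False
  interpret S: ring_rel "ratfun_rel R :: (('g, 'a) ratfun \<times> ('g, 'b) ratfun) set"
    by (rule ring_rel_ratfun_rel)
  interpret F: type_subfield "regrep_field G :: ('g, 'b) ratfun set"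
    by (rule type_subfield.intro) (rule subfield_regrep_field)
  obtain a b where ab: "z = Fract a b" "b \<noteq> 0" "mpoly_vars a \<subseteq> Var ` carrier G" "mpoly_vars b \<subseteq> Var ` carrier G"
    using z by (rule regrep_field_Fract)
  with False have "a \<noteq> 0" by (auto simp: fract_collapse)
  then obtain c and a' b' :: "('g var, 'b) mpoly" where c: "c \<noteq> 0" "a' \<noteq> 0" "b' \<noteq> 0"
    "mpoly_vars a' \<subseteq> mpoly_vars a" "mpoly_vars b' \<subseteq> mpoly_vars b"
    "(ratfun_const c * z, Fract a' b') \<in> ratfun_rel R"
    unfolding ab(1) using ab(2) by (rule exists_unit_multiple)
  have "Fract a' b' \<in> regrep_field G"
  proof (rule Fract_mem_subfield[OF subfield_regrep_field])
    fix x assume "x \<in> mpoly_vars a' \<union> mpoly_vars b'"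
    then have "x \<in> Var ` carrier G" using c(4,5) ab(3,4) by blast
    then show "ratfun_var (index x) \<in> regrep_field G" by (auto intro: ratfun_var_mem_regrep_field)
  qed (auto intro: ratfun_const_mem_regrep_field)
  show ?thesis
  proof (cases "inverse c \<in> Domain R")
    case True
    then obtain d where "(inverse c, d) \<in> R" by blast
    then have "(ratfun_const (inverse c) * (ratfun_const c * z), ratfun_const d * Fract a' b') \<in> ratfun_rel R"
      by (intro S.mult ratfun_rel_const c(6))
    moreover have "ratfun_const (inverse c) * (ratfun_const c * z) = z"
      using c(1) by (simp add: mult.assoc[symmetric] ratfun_const.mult[symmetric] ratfun_const.one)
    ultimately have "z' = ratfun_const d * Fract a' b'"
      using ratfun_rel_unique[OF rel] by metis
    then show ?thesis
      using F.mult[OF ratfun_const_mem_regrep_field \<open>Fract a' b' \<in> regrep_field G\<close>] by metis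
  next
    case False
    then have "(c, 0) \<in> R" using total[of "inverse c"] by simp
    then have "(ratfun_const c * z, ratfun_const 0 * z') \<in> ratfun_rel R"
      by (intro S.mult ratfun_rel_const rel)
    then have "Fract a' b' = 0"
      using ratfun_rel_unique[OF c(6)] by (metis mult_zero_left ratfun_const.zero)
    then show ?thesis using c(2,3) by (simp add: Zero_fract_def eq_fract)
  qed
qed

lemma ratfun_rename_comp:
  assumes "inj f" "inj g"
  shows "ratfun_rename f (ratfun_rename g z) = ratfun_rename (\<lambda>x. f (g x)) z"
proof (cases z)
  case (Fract a b)
  have fg: "inj (\<lambda>x. f (g x))" using inj_compose[OF assms] by (simp only: o_def)
  have b: "mpoly_rename (map_var g) b \<noteq> 0"
    using Fract(2) mpoly_rename_eq_0_iff[OF var.inj_map[OF assms(2)]] by blast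
  have map: "map_var f (map_var g x) = map_var (\<lambda>x. f (g x)) x" for x
    by (cases x) simp
  show ?thesis
    unfolding Fract(1) ratfun_rename_Fract[OF assms(2) Fract(2)] ratfun_rename_Fract[OF assms(1) b]
      ratfun_rename_Fract[OF fg Fract(2)] mpoly_rename_comp map ..
qed

lemma ratfun_rename_id: "ratfun_rename (\<lambda>x. x) z = z"
proof (cases z)
  case (Fract a b)
  have "mpoly_rename (map_var (\<lambda>x. x)) P = P" for P :: "('a var, 'b) mpoly"
    by (rule mpoly_rename_eq_self) (simp add: var.map_ident)
  moreover have "inj (\<lambda>x :: 'a. x)" by (simp add: inj_def)
  ultimately show ?thesis
    unfolding Fract(1) by (simp only: ratfun_rename_Fract[OF _ Fract(2)])
qed

lemma field_hom_ratfun_rename: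
  assumes "inj f"
  shows "field_hom (ratfun_rename f :: ('g, 'a::field) ratfun \<Rightarrow> _)"
proof
  show "ratfun_rename f (0 :: ('g, 'a) ratfun) = 0"
    using ratfun_rename_const[OF assms, of 0] by (metis ratfun_const.zero)
  show "ratfun_rename f (1 :: ('g, 'a) ratfun) = 1"
    using ratfun_rename_const[OF assms, of 1] by (metis ratfun_const.one)
qed (simp_all add: ratfun_rename_add[OF assms] ratfun_rename_mult[OF assms])

context group
begin

lemma field_hom_regrep_act: "g \<in> carrier G \<Longrightarrow> field_hom (regrep_act G g)"
  unfolding regrep_act_def by (intro field_hom_ratfun_rename inj_regrep_perm) (rule group_axioms)

lemma regrep_act_const: "g \<in> carrier G \<Longrightarrow> regrep_act G g (ratfun_const c) = ratfun_const c"
  unfolding regrep_act_def by (intro ratfun_rename_const inj_regrep_perm) (rule group_axioms)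

lemma regrep_act_one: "regrep_act G \<one> z = z"
proof -
  have "(\<lambda>h. if h \<in> carrier G then \<one> \<otimes> h else h) = (\<lambda>h. h)" by auto
  then show ?thesis unfolding regrep_act_def by (simp only: ratfun_rename_id)
qed

lemma regrep_act_mult:
  assumes "g \<in> carrier G" "h \<in> carrier G"
  shows "regrep_act G g (regrep_act G h z) = regrep_act G (g \<otimes> h) z"
proof -
  have "(\<lambda>x. if (if x \<in> carrier G then h \<otimes> x else x) \<in> carrier G
      then g \<otimes> (if x \<in> carrier G then h \<otimes> x else x) else (if x \<in> carrier G then h \<otimes> x else x))
    = (\<lambda>x. if x \<in> carrier G then g \<otimes> h \<otimes> x else x)"
    using assms by (auto simp: m_assoc)
  then show ?thesis
    unfolding regrep_act_def
    by (subst ratfun_rename_comp) (simp_all add: inj_regrep_perm[OF group_axioms] assms)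
qed

text \<open>
  By Sylow's theorem, another prime divisor \<open>q\<close> of the order would give a subgroup of order \<open>q\<close>,
  whose elements are killed by \<open>q\<close>.
\<close>
lemma card_subgroup_eq_prime_power:
  assumes p: "Factorial_Ring.prime p" and N: "subgroup N G" and fin: "finite (carrier G)"
    and tame: "\<And>g m. g \<in> N \<Longrightarrow> \<not> p dvd m \<Longrightarrow> g [^] (m :: nat) = \<one> \<Longrightarrow> g = \<one>"
  shows "\<exists>k. card N = p ^ k"
proof -
  have finN: "finite N" using N fin by (meson finite_subset subgroup.subset)
  have "N \<noteq> {}" using subgroup.one_closed[OF N] by blast
  then have pos: "card N \<noteq> 0" using finN by simp
  obtain k r where r: "card N = p ^ k * r" "\<not> p dvd r"
    using pos p by (metis multiplicity_decompose' not_prime_unit)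
  have "r = 1"
  proof (rule ccontr)
    assume "r \<noteq> 1"
    then obtain q where q: "Factorial_Ring.prime q" "q dvd r"
      using prime_factor_nat by blast
    then have "q \<noteq> p" using r(2) by blast
    obtain s where "r = q * s" using q(2) by (rule dvdE)
    with r(1) have "Coset.order (G\<lparr>carrier := N\<rparr>) = q ^ 1 * (p ^ k * s)"
      by (simp add: Coset.order_def)
    then obtain H where H: "subgroup H (G\<lparr>carrier := N\<rparr>)" "card H = q ^ 1"
      using sylow_thm[OF q(1) subgroup.subgroup_is_group[OF N group_axioms], of 1] finN by auto
    interpret N: group "G\<lparr>carrier := N\<rparr>" by (rule subgroup.subgroup_is_group[OF N group_axioms])
    have HG: "subgroup H G"
      using H(1) N by (rule incl_subgroup[rotated])
    have HN: "H \<subseteq> N" using subgroup.subset[OF H(1)] by simp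
    interpret H: group "G\<lparr>carrier := H\<rparr>" by (rule subgroup.subgroup_is_group[OF HG group_axioms])
    have "card H > 1" using H(2) q(1) prime_gt_1_nat by simp
    have "h = \<one>" if h: "h \<in> H" for h
    proof (rule tame)
      show "h \<in> N" using h HN by blast
      show "\<not> p dvd q" using p q(1) \<open>q \<noteq> p\<close> primes_dvd_imp_eq by blast
      show "h [^] q = \<one>"
        using H.pow_order_eq_1[of h] h H(2) by (simp add: Coset.order_def flip: nat_pow_consistent)
    qed
    then have "H \<subseteq> {\<one>}" by blast
    then have "card H \<le> 1" using card_mono[of "{\<one>}" H] by simp
    with \<open>card H > 1\<close> show False by simp
  qed
  with r show ?thesis by auto
qed

end

section \<open>Reduction of faithful invariant fields\<close>

text \<open>
  Choose a lift \<open>f s\<close> of each element \<open>s\<close> of an independent set of reductions. A relation between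
  the lifts, scaled to a primitive one, would reduce to a nontrivial relation between the
  reductions.
\<close>
lemma (in place) trdeg_reduction_le:
  fixes L :: "('g, 'a) ratfun set"
  shows "trdeg ratfun_const {z' :: ('g, 'b) ratfun. \<exists>z\<in>L. (z, z') \<in> ratfun_rel R} \<le> trdeg ratfun_const L"
  unfolding trdeg_def
proof (rule SUP_mono)
  let ?l = "{z' :: ('g, 'b) ratfun. \<exists>z\<in>L. (z, z') \<in> ratfun_rel R}"
  interpret S: ring_rel "ratfun_rel R :: (('g, 'a) ratfun \<times> ('g, 'b) ratfun) set"
    by (rule ring_rel_ratfun_rel)
  fix S assume "S \<in> {S. S \<subseteq> ?l \<and> finite S \<and> alg_independent ratfun_const S}"
  then have S: "S \<subseteq> ?l" "finite S" "alg_independent ratfun_const S" by auto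
  then obtain f where f: "\<And>s. s \<in> S \<Longrightarrow> f s \<in> L" "\<And>s. s \<in> S \<Longrightarrow> (f s, s) \<in> ratfun_rel R"
    by (auto simp: subset_iff) metis
  have inj: "inj_on f S"
    by (rule inj_onI) (use f(2) ratfun_rel_unique in metis)
  define g where "g = the_inv_into S f"
  have gf: "g (f s) = s" if "s \<in> S" for s
    unfolding g_def by (rule the_inv_into_f_f[OF inj that])
  have "alg_independent ratfun_const (f ` S)"
    unfolding alg_independent_def
  proof (intro allI impI)
    fix P :: "(('g, 'a) ratfun, 'a) mpoly"
    assume vars: "mpoly_vars P \<subseteq> f ` S" and ev: "mpoly_eval ratfun_const (\<lambda>s. s) P = 0"
    show "P = 0"
    proof (rule ccontr)
      assume "P \<noteq> 0"
      then obtain c and Q :: "(('g, 'a) ratfun, 'b) mpoly" where Q: "c \<noteq> 0" "Q \<noteq> 0"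
        "(mpoly_const c * P, Q) \<in> mpoly_rel R"
        by (rule exists_primitive_multiple)
      have varsP: "mpoly_vars (mpoly_const c * P) \<subseteq> f ` S"
        using vars by (intro mpoly_vars_mult_le) simp_all
      then have varsQ: "mpoly_vars Q \<subseteq> f ` S"
        using mpoly_rel_vars[OF Q(3)] by blast
      \<comment> \<open>The variables of \<open>Q\<close> are still the lifts; \<open>g\<close> sends them back to their reductions.\<close>
      have "(mpoly_eval ratfun_const (\<lambda>s. s) (mpoly_const c * P), mpoly_eval ratfun_const g Q)
          \<in> (ratfun_rel R :: (('g, 'a) ratfun \<times> ('g, 'b) ratfun) set)"
      proof (rule mpoly_eval_rel[OF ring_rel_ratfun_rel Q(3)])
        fix x assume "x \<in> mpoly_vars (mpoly_const c * P) \<union> mpoly_vars Q"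
        then obtain s where "s \<in> S" "x = f s" using varsP varsQ by blast
        then show "(x, g x) \<in> ratfun_rel R" using f(2) gf by metis
      qed (simp_all add: ratfun_rel_const ratfun_const.zero)
      then have "mpoly_eval ratfun_const g Q = 0"
        by (intro ratfun_rel_functional) (simp add: ratfun_const.eval_mult ev)
      then have "mpoly_eval ratfun_const (\<lambda>s. s) (mpoly_rename g Q) = 0"
        by (simp add: ratfun_const.eval_rename)
      moreover have "mpoly_vars (mpoly_rename g Q) \<subseteq> S"
        using mpoly_vars_rename[of g Q] varsQ gf by fastforce
      ultimately have "mpoly_rename g Q = 0"
        using S(3) unfolding alg_independent_def by blast
      then have "mpoly_rename (\<lambda>x. f (g x)) Q = 0"
        by (metis mpoly_rename_comp mpoly_rename_zero)
      moreover have "mpoly_rename (\<lambda>x. f (g x)) Q = Q"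
        using varsQ gf by (intro mpoly_rename_eq_self) auto
      ultimately show False using Q(2) by simp
    qed
  qed
  moreover have "f ` S \<subseteq> L" using f(1) by blast
  moreover have "card (f ` S) = card S" by (rule card_image[OF inj])
  ultimately show "\<exists>T\<in>{T. T \<subseteq> L \<and> finite T \<and> alg_independent ratfun_const T}. enat (card S) \<le> enat (card T)"
    using S(2) by (intro bexI[of _ "f ` S"]) auto
qed

text \<open>
  The new field is generated by the reductions of \<open>L\<close>. The constants have to be added because the
  residue field of the place may be smaller than the target field.
\<close>
lemma (in place) faithful_subfield_reduction:
  fixes G :: "('g, 'm) monoid_scheme" and L :: "('g, 'a) ratfun set"
  assumes p: "Factorial_Ring.prime p" "CHAR('b) = p" and "Group.group G" and fin: "finite (carrier G)"
    and tame: "weakly_tame p G" and L: "L \<in> faithful_subfields G"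
  shows "\<exists>L' \<in> faithful_subfields G. trdeg (ratfun_const :: 'b \<Rightarrow> ('g, 'b) ratfun) L' \<le> trdeg ratfun_const L"
proof -
  interpret group G by fact
  interpret S: ring_rel "ratfun_rel R :: (('g, 'a) ratfun \<times> ('g, 'b) ratfun) set"
    by (rule ring_rel_ratfun_rel)
  have subf: "subfield L ring_of_type_algebra" and constL: "range ratfun_const \<subseteq> L"
    and LV: "L \<subseteq> regrep_field G" and inv: "\<And>g z. g \<in> carrier G \<Longrightarrow> z \<in> L \<Longrightarrow> regrep_act G g z \<in> L"
    and faithful: "\<And>g. g \<in> carrier G \<Longrightarrow> (\<And>z. z \<in> L \<Longrightarrow> regrep_act G g z = z) \<Longrightarrow> g = \<one>\<^bsub>G\<^esub>"
    using L unfolding faithful_subfields_def by blast+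
  interpret L: type_subfield L using subf by (rule type_subfield.intro)
  define l where "l = {z' :: ('g, 'b) ratfun. \<exists>z\<in>L. (z, z') \<in> ratfun_rel R}"
  define L' where "L' = ratfun_const.base_closure l"
  have act_rel: "(regrep_act G g z, regrep_act G g z') \<in> ratfun_rel R"
    if "g \<in> carrier G" "(z, z') \<in> ratfun_rel R" for g and z :: "('g, 'a) ratfun" and z' :: "('g, 'b) ratfun"
    unfolding regrep_act_def by (rule ratfun_rel_rename[OF inj_regrep_perm[OF group_axioms that(1)] that(2)])
  have act_l: "regrep_act G g z \<in> l" if g: "g \<in> carrier G" and z: "z \<in> l" for g z
    using z act_rel[OF g] inv[OF g] unfolding l_def by blast
  \<comment> \<open>The inertia group.\<close>
  define N where "N = {g \<in> carrier G. \<forall>z\<in>l. regrep_act G g z = z}"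
  have N: "subgroup N G"
  proof (rule subgroupI)
    show "N \<noteq> {}" unfolding N_def using regrep_act_one by auto
    show "inv\<^bsub>G\<^esub> g \<in> N" if "g \<in> N" for g
      using that unfolding N_def by (auto) (metis inv_closed l_inv regrep_act_mult regrep_act_one)
    show "g \<otimes>\<^bsub>G\<^esub> h \<in> N" if "g \<in> N" "h \<in> N" for g h
      using that unfolding N_def by (auto simp flip: regrep_act_mult)
  qed (auto simp: N_def)
  have "N \<lhd> G"
    unfolding normal_inv_iff
  proof (intro conjI N ballI)
    fix g h assume g: "g \<in> carrier G" and h: "h \<in> N"
    then have hc: "h \<in> carrier G" by (simp add: N_def)
    have "regrep_act G (g \<otimes>\<^bsub>G\<^esub> h \<otimes>\<^bsub>G\<^esub> inv\<^bsub>G\<^esub> g) z = z" if z: "z \<in> l" for z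
    proof -
      have "regrep_act G (g \<otimes>\<^bsub>G\<^esub> h \<otimes>\<^bsub>G\<^esub> inv\<^bsub>G\<^esub> g) z
          = regrep_act G g (regrep_act G h (regrep_act G (inv\<^bsub>G\<^esub> g) z))"
        using g hc by (simp add: regrep_act_mult m_assoc)
      also have "regrep_act G h (regrep_act G (inv\<^bsub>G\<^esub> g) z) = regrep_act G (inv\<^bsub>G\<^esub> g) z"
        using h act_l[OF inv_closed[OF g] z] unfolding N_def by blast
      also have "regrep_act G g (regrep_act G (inv\<^bsub>G\<^esub> g) z) = z"
        using g by (simp add: regrep_act_mult regrep_act_one)
      finally show ?thesis .
    qed
    then show "g \<otimes>\<^bsub>G\<^esub> h \<otimes>\<^bsub>G\<^esub> inv\<^bsub>G\<^esub> g \<in> N"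
      unfolding N_def using g hc by simp
  qed
  have "g = \<one>\<^bsub>G\<^esub>" if g: "g \<in> N" and m: "\<not> p dvd m" "g [^]\<^bsub>G\<^esub> (m :: nat) = \<one>\<^bsub>G\<^esub>" for g m
  proof (rule ccontr)
    assume "g \<noteq> \<one>\<^bsub>G\<^esub>"
    have gc: "g \<in> carrier G" using g by (simp add: N_def)
    then obtain a where a: "a \<in> L" "regrep_act G g a \<noteq> a" using faithful \<open>g \<noteq> \<one>\<^bsub>G\<^esub>\<close> by blast
    let ?act = "\<lambda>i. regrep_act G (g [^]\<^bsub>G\<^esub> (i :: nat))"
    define w where "w = regrep_act G g a - a"
    have "w \<in> L" unfolding w_def by (intro L.diff inv gc a(1))
    have "w \<noteq> 0" using a(2) by (simp add: w_def)
    \<comment> \<open>Since \<open>w\<close> has trivial trace under \<open>g\<close>, so has the unit \<open>c w\<close>, but the trace of a unit reduces to \<open>m u\<close>.\<close>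
    obtain P Q where PQ: "w = Fract P Q" "Q \<noteq> 0" by (cases w)
    then have "P \<noteq> 0" using \<open>w \<noteq> 0\<close> by (auto simp: fract_collapse)
    then obtain c and P' Q' :: "('g var, 'b) mpoly" where c: "P' \<noteq> 0" "Q' \<noteq> 0"
      "(ratfun_const c * w, Fract P' Q') \<in> ratfun_rel R"
      unfolding PQ(1) using PQ(2) by (rule exists_unit_multiple)
    define u where "u = Fract P' Q'"
    have "u \<noteq> 0" using c(1,2) by (simp add: u_def Zero_fract_def eq_fract)
    have rel: "(ratfun_const c * w, u) \<in> ratfun_rel R" using c(3) by (simp add: u_def)
    then have "u \<in> l" unfolding l_def using constL \<open>w \<in> L\<close> by (blast intro: L.mult)
    have pow: "g [^]\<^bsub>G\<^esub> i \<in> N" for i :: nat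
      by (induction i) (simp_all add: subgroup.one_closed[OF N] subgroup.m_closed[OF N] g)
    have powc: "g [^]\<^bsub>G\<^esub> i \<in> carrier G" for i :: nat using gc by simp
    have "(\<Sum>i<m. ?act i (ratfun_const c * w), \<Sum>i<m. ?act i u) \<in> ratfun_rel R"
      by (intro S.sum act_rel powc rel)
    moreover have "(\<Sum>i<m. ?act i (ratfun_const c * w)) = 0"
    proof -
      have "?act i (ratfun_const c * w) = ratfun_const c * (?act (Suc i) a - ?act i a)" for i
      proof -
        interpret A: field_hom "?act i :: ('g, 'a) ratfun \<Rightarrow> _" by (rule field_hom_regrep_act[OF powc])
        have "?act i (regrep_act G g a) = ?act (Suc i) a"
          using regrep_act_mult[OF powc gc, of i a] by simp
        then show ?thesis
          by (simp add: w_def A.mult A.diff regrep_act_const[OF powc])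
      qed
      then have "(\<Sum>i<m. ?act i (ratfun_const c * w)) = ratfun_const c * (\<Sum>i<m. ?act (Suc i) a - ?act i a)"
        by (simp only: sum_distrib_left)
      also have "(\<Sum>i<m. ?act (Suc i) a - ?act i a) = ?act m a - ?act 0 a"
        by (rule sum_lessThan_telescope)
      also have "\<dots> = 0" by (simp add: m(2))
      finally show ?thesis by simp
    qed
    moreover have "(\<Sum>i<m. ?act i u) = of_nat m * u"
    proof -
      have "?act i u = u" for i using pow[of i] \<open>u \<in> l\<close> unfolding N_def by blast
      then show ?thesis by simp
    qed
    ultimately have "of_nat m * u = 0"
      using ratfun_rel_functional by metis
    with \<open>u \<noteq> 0\<close> have "(of_nat m :: ('g, 'b) ratfun) = 0" by simp
    moreover have "(of_nat m :: ('g, 'b) ratfun) = ratfun_const (of_nat m)"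
      by (induction m) (simp_all add: ratfun_const.zero ratfun_const.one ratfun_const.add)
    ultimately have "(of_nat m :: 'b) = 0" by (simp add: ratfun_const.eq_0_iff)
    with m(1) p(2) show False by (simp add: of_nat_eq_0_iff_char_dvd)
  qed
  then have "\<exists>k. card N = p ^ k"
    by (rule card_subgroup_eq_prime_power[OF p(1) N fin])
  with \<open>N \<lhd> G\<close> tame have N1: "N = {\<one>\<^bsub>G\<^esub>}"
    unfolding weakly_tame_def by blast
  have "L' \<in> faithful_subfields G"
    unfolding faithful_subfields_def
  proof (intro CollectI conjI ballI impI)
    show "subfield L' ring_of_type_algebra" "range ratfun_const \<subseteq> L'"
      unfolding L'_def by (rule ratfun_const.subfield_base_closure ratfun_const.base_closure_ge)+
    show "L' \<subseteq> regrep_field G"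
      unfolding L'_def
    proof (rule ratfun_const.base_closure_le[OF subfield_regrep_field])
      show "l \<subseteq> regrep_field G"
        unfolding l_def using LV regrep_field_reduction by blast
    qed (auto intro: ratfun_const_mem_regrep_field)
  next
    fix g assume g: "g \<in> carrier G"
    interpret A: field_hom "regrep_act G g :: ('g, 'b) ratfun \<Rightarrow> _" by (rule field_hom_regrep_act[OF g])
    interpret L': type_subfield L'
      unfolding L'_def by (rule type_subfield.intro) (rule ratfun_const.subfield_base_closure)
    have l: "l \<subseteq> L'" and const: "range ratfun_const \<subseteq> L'"
      unfolding L'_def by (rule ratfun_const.base_closure_ge)+
    have "L' \<subseteq> {z. regrep_act G g z \<in> L'}"
    proof -
      have "ratfun_const.base_closure l \<subseteq> {z. regrep_act G g z \<in> L'}"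
      proof (rule ratfun_const.base_closure_le)
        show "subfield {z. regrep_act G g z \<in> L'} ring_of_type_algebra"
          unfolding subfield_type_iff
          by (auto simp: A.one A.diff A.mult A.inverse L'.one intro: L'.diff L'.mult L'.inverse)
        show "range ratfun_const \<subseteq> {z. regrep_act G g z \<in> L'}"
          using const by (auto simp: regrep_act_const[OF g])
        show "l \<subseteq> {z. regrep_act G g z \<in> L'}"
          using act_l[OF g] l by blast
      qed
      then show ?thesis by (simp add: L'_def)
    qed
    then show "regrep_act G g ` L' \<subseteq> L'" by blast
    assume "\<forall>z\<in>L'. regrep_act G g z = z"
    then have "g \<in> N" unfolding N_def using g l by blast
    then show "g = \<one>\<^bsub>G\<^esub>" using N1 by blast
  qed
  moreover have "trdeg ratfun_const L' \<le> trdeg ratfun_const L"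
    unfolding L'_def l_def by (rule order_trans[OF ratfun_const.trdeg_base_closure_le trdeg_reduction_le])
  ultimately show ?thesis by blast
qed

lemma (in place) essential_dimension_specialise:
  fixes G :: "('g, 'm) monoid_scheme"
  assumes "Factorial_Ring.prime p" "CHAR('b) = p" "Group.group G" "finite (carrier G)" "weakly_tame p G"
  shows "essential_dimension TYPE('b) G \<le> essential_dimension TYPE('a) G"
  unfolding essential_dimension_def
  by (rule INF_mono) (rule faithful_subfield_reduction[OF assms])

section \<open>Existence of places\<close>

text \<open>
  Write \<open>x\<close> in lowest terms. If \<open>x\<close> has no reduction, the denominator vanishes in the target field;
  then by Bezout the numerator does not, so that the inverse of \<open>x\<close> reduces to \<open>0\<close>.
\<close>
lemma place_rat: "place {(of_int a / of_int b :: rat, of_int a / of_int b :: 'b::field) | a b. of_int b \<noteq> (0 :: 'b)}"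
  (is "place ?R")
proof
  have memI: "(x, y) \<in> ?R" if "x = of_int a / of_int b" "y = of_int a / of_int b" "of_int b \<noteq> (0 :: 'b)" for x y a b
    using that by blast
  show "(1, 1) \<in> ?R" by (rule memI[of _ 1 1]) simp_all
  fix x z y w assume "(x, y) \<in> ?R" "(z, w) \<in> ?R"
  then obtain a b c d where *: "x = of_int a / of_int b" "y = of_int a / of_int b" "of_int b \<noteq> (0 :: 'b)"
    "z = of_int c / of_int d" "w = of_int c / of_int d" "of_int d \<noteq> (0 :: 'b)" by blast
  then have nz: "b \<noteq> 0" "d \<noteq> 0" by auto
  show "(x - z, y - w) \<in> ?R"
    by (rule memI[of _ "a * d - c * b" "b * d"]) (use * nz in \<open>simp_all add: diff_frac_eq\<close>)
  show "(x * z, y * w) \<in> ?R"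
    by (rule memI[of _ "a * c" "b * d"]) (use * in simp_all)
next
  fix y assume "(0, y) \<in> ?R"
  then obtain a b where *: "0 = (of_int a / of_int b :: rat)" "y = of_int a / of_int b" "of_int b \<noteq> (0 :: 'b)" by blast
  then have "a = 0" by auto
  then show "y = 0" by (simp add: *(2))
next
  fix x assume x: "x \<notin> Domain ?R"
  obtain a b where ab: "quotient_of x = (a, b)" by force
  have xab: "x = of_int a / of_int b" by (rule quotient_of_div[OF ab])
  have b: "of_int b = (0 :: 'b)"
    using x xab by blast
  have "of_int a \<noteq> (0 :: 'b)"
  proof
    assume a: "of_int a = (0 :: 'b)"
    obtain u v where "u * a + v * b = 1"
      using quotient_of_coprime[OF ab] by (metis coprime_iff_gcd_eq_1 bezout_int)
    then have "(of_int u * of_int a + of_int v * of_int b :: 'b) = 1"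
      by (metis of_int_1 of_int_add of_int_mult)
    then show False by (simp add: a b)
  qed
  then have "(of_int b / of_int a, of_int b / of_int a) \<in> ?R" by blast
  then show "(inverse x, 0) \<in> ?R" by (simp add: xab b)
qed

lemma place_comp:
  fixes h :: "'b::field \<Rightarrow> 'c::field"
  assumes "place R" and h: "h \<in> ring_hom ring_of_type_algebra ring_of_type_algebra"
  shows "place {(a, h b) | a b. (a, b) \<in> R}"
proof -
  interpret place R by fact
  have hom: "h 1 = 1" "h (x * y) = h x * h y" "h (x + y) = h x + h y" for x y
    using ring_hom_one[OF h] ring_hom_mult[OF h, of x y] ring_hom_add[OF h, of x y] by simp_all
  have h0: "h 0 = 0" using hom(3)[of 0 0] by (metis add_0 add_cancel_right_right)
  have hdiff: "h (x - y) = h x - h y" for x y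
    using hom(3)[of "x - y" y] by (simp add: eq_diff_eq)
  show ?thesis
  proof
    show "(1, 1) \<in> {(a, h b) | a b. (a, b) \<in> R}" using one hom(1) by force
  next
    fix a b c d assume "(a, b) \<in> {(a, h b) | a b. (a, b) \<in> R}" "(c, d) \<in> {(a, h b) | a b. (a, b) \<in> R}"
    then obtain b' d' where *: "b = h b'" "d = h d'" "(a, b') \<in> R" "(c, d') \<in> R" by blast
    show "(a - c, b - d) \<in> {(a, h b) | a b. (a, b) \<in> R}"
      unfolding *(1,2) hdiff[symmetric] using diff[OF *(3,4)] by blast
    show "(a * c, b * d) \<in> {(a, h b) | a b. (a, b) \<in> R}"
      unfolding *(1,2) hom(2)[symmetric] using mult[OF *(3,4)] by blast
  next
    fix b assume "(0, b) \<in> {(a, h b) | a b. (a, b) \<in> R}"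
    then obtain b' where "b = h b'" "(0, b') \<in> R" by blast
    then show "b = 0" using functional h0 by blast
  next
    fix a assume "a \<notin> Domain {(a, h b) | a b. (a, b) \<in> R}"
    then have "a \<notin> Domain R" by blast
    then have "(inverse a, 0) \<in> R" by (rule total)
    then show "(inverse a, 0) \<in> {(a, h b) | a b. (a, b) \<in> R}" using h0 by force
  qed
qed

definition upoly_rel :: "('a::comm_ring_1 \<times> 'b::comm_ring_1) set \<Rightarrow> ('a poly \<times> 'b poly) set" where
  "upoly_rel R = {(F, f). \<forall>i. (poly.coeff F i, poly.coeff f i) \<in> R}"

lemma upoly_relI: "(\<And>i. (poly.coeff F i, poly.coeff f i) \<in> R) \<Longrightarrow> (F, f) \<in> upoly_rel R"
  by (simp add: upoly_rel_def)

lemma upoly_relD: "(F, f) \<in> upoly_rel R \<Longrightarrow> (poly.coeff F i, poly.coeff f i) \<in> R"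
  by (simp add: upoly_rel_def)

context ring_rel
begin

lemma upoly_rel_monom: "(a, b) \<in> R \<Longrightarrow> (Polynomial.monom a n, Polynomial.monom b n) \<in> upoly_rel R"
  by (rule upoly_relI) (simp add: zero)

lemma ring_rel_upoly_rel: "ring_rel (upoly_rel R)"
proof
  show "(1, 1) \<in> upoly_rel R"
    using upoly_rel_monom[OF one, of 0] by (simp add: monom_0 flip: one_pCons)
  fix F F' f f' assume rel: "(F, f) \<in> upoly_rel R" "(F', f') \<in> upoly_rel R"
  show "(F - F', f - f') \<in> upoly_rel R"
    by (rule upoly_relI) (simp add: diff upoly_relD[OF rel(1)] upoly_relD[OF rel(2)])
  show "(F * F', f * f') \<in> upoly_rel R"
    by (rule upoly_relI) (unfold coeff_mult, intro sum mult upoly_relD[OF rel(1)] upoly_relD[OF rel(2)])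
qed

lemma ring_rel_adjoin: "ring_rel {(poly F x, poly f y) | F f. (F, f) \<in> upoly_rel R}"
proof -
  interpret U: ring_rel "upoly_rel R" by (rule ring_rel_upoly_rel)
  show ?thesis
  proof
    show "(1, 1) \<in> {(poly F x, poly f y) | F f. (F, f) \<in> upoly_rel R}"
      using U.one by force
  next
    fix a b c d assume "(a, b) \<in> {(poly F x, poly f y) | F f. (F, f) \<in> upoly_rel R}"
      "(c, d) \<in> {(poly F x, poly f y) | F f. (F, f) \<in> upoly_rel R}"
    then obtain F f F' f' where *: "a = poly F x" "b = poly f y" "c = poly F' x" "d = poly f' y"
      "(F, f) \<in> upoly_rel R" "(F', f') \<in> upoly_rel R" by blast
    show "(a - c, b - d) \<in> {(poly F x, poly f y) | F f. (F, f) \<in> upoly_rel R}"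
      unfolding *(1-4) poly_diff[symmetric] using U.diff[OF *(5,6)] by blast
    show "(a * c, b * d) \<in> {(poly F x, poly f y) | F f. (F, f) \<in> upoly_rel R}"
      unfolding *(1-4) poly_mult[symmetric] using U.mult[OF *(5,6)] by blast
  qed
qed

end

text \<open>
  Chevalley's construction: a homomorphism from a subring to an algebraically closed field that
  has no proper extension to a larger subring is a place.
\<close>
locale partial_hom = ring_rel R for R :: "('a::field \<times> 'b::field) set" +
  assumes functional: "(0, b) \<in> R \<Longrightarrow> b = 0"

locale maximal_partial_hom = partial_hom R for R :: "('a::field \<times> 'b::alg_closed_field) set" +
  assumes maximal: "partial_hom S \<Longrightarrow> R \<subseteq> S \<Longrightarrow> S = R"
begin

text \<open>A partial homomorphism extends to the localisation at an element with nonzero image.\<close>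
lemma inverse_rel:
  assumes ab: "(a, b) \<in> R" and "b \<noteq> 0"
  shows "(inverse a, inverse b) \<in> R"
proof -
  have "a \<noteq> 0" using functional assms by blast
  let ?S = "{(x / a ^ n, y / b ^ n) | x y n. (x, y) \<in> R}"
  have memI: "(u, v) \<in> ?S" if "u = x / a ^ n" "v = y / b ^ n" "(x, y) \<in> R" for u v x y n
    using that by blast
  have "partial_hom ?S"
  proof
    show "(1, 1) \<in> ?S" by (rule memI[of _ 1 0 _ 1]) (simp_all add: one)
  next
    fix u v u' v' assume "(u, v) \<in> ?S" "(u', v') \<in> ?S"
    then obtain x y n x' y' n' where *: "u = x / a ^ n" "v = y / b ^ n" "u' = x' / a ^ n'" "v' = y' / b ^ n'"
      and rel: "(x, y) \<in> R" "(x', y') \<in> R" by blast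
    show "(u - u', v - v') \<in> ?S"
    proof (rule memI[of _ "x * a ^ n' - x' * a ^ n" "n + n'" _ "y * b ^ n' - y' * b ^ n"])
      show "(x * a ^ n' - x' * a ^ n, y * b ^ n' - y' * b ^ n) \<in> R"
        by (intro diff mult power rel ab)
    qed (use \<open>a \<noteq> 0\<close> \<open>b \<noteq> 0\<close> in \<open>simp_all add: * diff_frac_eq power_add\<close>)
    show "(u * u', v * v') \<in> ?S"
      by (rule memI[of _ "x * x'" "n + n'" _ "y * y'"]) (simp_all add: * power_add mult rel)
  next
    fix v assume "(0, v) \<in> ?S"
    then obtain x y n where "0 = x / a ^ n" "v = y / b ^ n" "(x, y) \<in> R" by blast
    then show "v = 0" using \<open>a \<noteq> 0\<close> functional by auto
  qed
  moreover have "R \<subseteq> ?S"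
  proof
    fix z assume "z \<in> R"
    then show "z \<in> ?S"
    proof (cases z)
      case (Pair c d)
      with \<open>z \<in> R\<close> show ?thesis
        unfolding Pair by (intro memI[of c c 0 d d]) simp_all
    qed
  qed
  ultimately have "?S = R" by (rule maximal)
  moreover have "(inverse a, inverse b) \<in> ?S"
    by (rule memI[of _ 1 1 _ 1]) (simp_all add: one field_class.field_divide_inverse)
  ultimately show ?thesis by blast
qed

text \<open>
  The images \<open>J\<close> of the integral polynomials that vanish at \<open>x\<close> form an ideal in the polynomials over
  the residue field. If it were proper, its elements would have a common root \<open>w\<close> in the algebraically closed
  target, and \<open>x \<mapsto> w\<close> would extend the homomorphism.
\<close>
lemma relation_of_not_in_Domain:
  assumes x: "x \<notin> Domain R"
  obtains F where "(F, 1) \<in> upoly_rel R" "poly F x = 0"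
proof -
  interpret U: ring_rel "upoly_rel R" by (rule ring_rel_upoly_rel)
  define J where "J = {f. \<exists>F. (F, f) \<in> upoly_rel R \<and> poly F x = 0}"
  have J_mult: "g * f \<in> J" if "(H, g) \<in> upoly_rel R" "f \<in> J" for H g f
    using that U.mult unfolding J_def by force
  have J_diff: "f - g \<in> J" if "f \<in> J" "g \<in> J" for f g
    using that U.diff unfolding J_def by force
  have J_coeff: "poly.coeff f i \<in> Range R" if "f \<in> J" for f i
    using that upoly_relD unfolding J_def by blast
  have Range_inverse: "inverse c \<in> Range R" if "c \<in> Range R" "c \<noteq> 0" for c
    using that inverse_rel by blast
  have J_monom_mult: "Polynomial.monom c k * f \<in> J" if "c \<in> Range R" "f \<in> J" for c k f
    using that J_mult upoly_rel_monom by blast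
  have "1 \<in> J"
  proof (rule ccontr)
    assume one: "1 \<notin> J"
    have "\<exists>w. \<forall>f\<in>J. poly f w = 0"
    proof (cases "J \<subseteq> {0}")
      case True
      then show ?thesis by (intro exI[of _ 0]) auto
    next
      case False
      then obtain f where f: "f \<in> J" "f \<noteq> 0"
        and min: "\<And>g. g \<in> J \<Longrightarrow> g \<noteq> 0 \<Longrightarrow> Polynomial.degree f \<le> Polynomial.degree g"
        using ex_has_least_nat[of "\<lambda>f. f \<in> J \<and> f \<noteq> 0" _ Polynomial.degree] by blast
      let ?c = "poly.coeff f (Polynomial.degree f)"
      have c: "inverse ?c \<in> Range R" "?c \<noteq> 0"
        using f by (auto intro!: Range_inverse J_coeff)
      \<comment> \<open>A nonzero constant in \<open>J\<close> could be scaled to \<open>1\<close>.\<close>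
      have "Polynomial.degree f \<noteq> 0"
      proof
        assume d: "Polynomial.degree f = 0"
        then have "Polynomial.monom (inverse ?c) 0 * f = 1"
          using c(2) by (auto elim!: degree_eq_zeroE simp: monom_0 one_pCons)
        with J_monom_mult[OF c(1) f(1), of 0] one show False by simp
      qed
      then obtain w where w: "poly f w = 0"
        using alg_closed_imp_poly_has_root[of f] by blast
      \<comment> \<open>Long division: \<open>f\<close> has least degree, so it divides every element of \<open>J\<close>.\<close>
      have "poly g w = 0" if "g \<in> J" for g
        using that
      proof (induction "Polynomial.degree g" arbitrary: g rule: less_induct)
        case less
        show ?case
        proof (cases "g = 0")
          case False
          let ?n = "Polynomial.degree g"
          let ?k = "?n - Polynomial.degree f"
          let ?m = "Polynomial.monom (poly.coeff g ?n * inverse ?c) ?k * f"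
          have le: "Polynomial.degree f \<le> ?n" by (rule min[OF less.prems False])
          obtain a a' where "(a, poly.coeff g ?n) \<in> R" "(a', inverse ?c) \<in> R"
            using J_coeff[OF less.prems, of ?n] c(1) by blast
          then have "poly.coeff g ?n * inverse ?c \<in> Range R"
            using mult by blast
          then have J: "g - ?m \<in> J"
            by (intro J_diff less.prems J_monom_mult f(1))
          have "poly.coeff (g - ?m) ?n = 0"
            using le c(2) by (simp add: coeff_monom_mult)
          moreover have "Polynomial.degree (g - ?m) \<le> ?n"
          proof (rule degree_diff_le)
            have "Polynomial.degree ?m \<le> ?k + Polynomial.degree f"
              by (rule order_trans[OF degree_mult_le]) (simp add: degree_monom_le)
            then show "Polynomial.degree ?m \<le> ?n" using le by simp
          qed simp
          ultimately have "g - ?m = 0 \<or> Polynomial.degree (g - ?m) < ?n"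
            by (metis eq_zero_or_degree_less)
          then have "poly (g - ?m) w = 0"
            using less.hyps[OF _ J] by (metis poly_0)
          then show ?thesis by (simp add: w)
        qed simp
      qed
      then show ?thesis by blast
    qed
    then obtain w where w: "\<And>f. f \<in> J \<Longrightarrow> poly f w = 0" by blast
    let ?S = "{(poly F x, poly f w) | F f. (F, f) \<in> upoly_rel R}"
    have "partial_hom ?S"
    proof (intro partial_hom.intro ring_rel_adjoin partial_hom_axioms.intro)
      fix b assume "(0, b) \<in> ?S"
      then obtain F f where "poly F x = 0" "b = poly f w" "(F, f) \<in> upoly_rel R" by auto
      then show "b = 0" using w[of f] unfolding J_def by blast
    qed
    moreover have "R \<subseteq> ?S"
    proof
      fix z assume "z \<in> R"
      then obtain a b where ab: "z = (a, b)" "(a, b) \<in> R" by (cases z) auto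
      have "z = (poly (Polynomial.monom a 0) x, poly (Polynomial.monom b 0) w)"
        by (simp add: ab poly_monom)
      then show "z \<in> ?S" using upoly_rel_monom[OF ab(2), of 0] by blast
    qed
    ultimately have "?S = R" by (rule maximal)
    moreover have "(poly (Polynomial.monom 1 1) x, poly (Polynomial.monom 1 1) w) \<in> ?S"
      using upoly_rel_monom[OF ring_rel.one[OF ring_rel_axioms], of 1] by blast
    ultimately have "(x, w) \<in> R" by (simp add: poly_monom)
    with x show False by blast
  qed
  then show thesis using that unfolding J_def by blast
qed

text \<open>
  Both relations have constant term a unit and all other coefficients in the kernel. The one for
  the inverse of \<open>x\<close>, multiplied by a power of \<open>x\<close>, has an invertible leading coefficient and can be
  used to lower the degree of the one for \<open>x\<close>, when that degree is at least as large; otherwise the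
  roles are exchanged.
\<close>
lemma no_opposite_relations:
  assumes "x \<noteq> 0" "(F, 1) \<in> upoly_rel R" "poly F x = 0" "(H, 1) \<in> upoly_rel R" "poly H (inverse x) = 0"
  shows False
  using assms
proof (induction "Polynomial.degree F + Polynomial.degree H" arbitrary: x F H rule: less_induct)
  case less
  interpret U: ring_rel "upoly_rel R" by (rule ring_rel_upoly_rel)
  have False
    if le: "Polynomial.degree H \<le> Polynomial.degree F" and x: "x \<noteq> 0"
      and F: "(F, 1) \<in> upoly_rel R" "poly F x = 0" and H: "(H, 1) \<in> upoly_rel R" "poly H (inverse x) = 0"
      and IH: "\<And>F'. Polynomial.degree F' < Polynomial.degree F \<Longrightarrow> (F', 1) \<in> upoly_rel R \<Longrightarrow> poly F' x = 0 \<Longrightarrow> False"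
    for x F H
  proof -
    let ?n = "Polynomial.degree F" and ?m = "Polynomial.degree H"
    define b where "b = poly.coeff H 0"
    define a where "a = poly.coeff F ?n"
    have b: "(b, 1) \<in> R" using upoly_relD[OF H(1), of 0] by (simp add: b_def)
    then have "b \<noteq> 0" using functional by force
    show False
    proof (cases "?n = 0")
      case True
      then have "F = 0" using F(2) by (auto elim: degree_eq_zeroE)
      with upoly_relD[OF F(1), of 0] functional show False by force
    next
      case False
      have "(a, 0) \<in> R"
        using upoly_relD[OF F(1), of ?n] False by (simp add: a_def)
      have refl: "(reflect_poly H, Polynomial.monom 1 ?m) \<in> upoly_rel R"
      proof (rule upoly_relI)
        fix i
        show "(poly.coeff (reflect_poly H) i, poly.coeff (Polynomial.monom 1 ?m) i) \<in> R"
          using upoly_relD[OF H(1), of "?m - i"] b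
          by (auto simp: coeff_reflect_poly zero b_def)
      qed
      \<comment> \<open>Cancels the leading term; the multiplier reduces to \<open>0\<close>, so \<open>F'\<close> still reduces to \<open>1\<close>.\<close>
      define F' where "F' = F - Polynomial.monom (a * inverse b) (?n - ?m) * reflect_poly H"
      have "(a * inverse b, 0 * inverse 1) \<in> R"
        by (intro mult inverse_rel b \<open>(a, 0) \<in> R\<close>) simp
      then have "(F', 1 - Polynomial.monom (0 * inverse 1) (?n - ?m) * Polynomial.monom 1 ?m) \<in> upoly_rel R"
        unfolding F'_def by (intro U.diff U.mult upoly_rel_monom F(1) refl)
      then have F'1: "(F', 1) \<in> upoly_rel R" by simp
      have "poly (reflect_poly H) x = 0"
        by (simp add: poly_reflect_poly_nz[OF x] H(2))
      then have F'2: "poly F' x = 0" by (simp add: F'_def F(2))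
      have "poly.coeff F' ?n = 0"
        using le \<open>b \<noteq> 0\<close> by (simp add: F'_def coeff_monom_mult coeff_reflect_poly a_def flip: b_def)
      moreover have "Polynomial.degree F' \<le> ?n"
        unfolding F'_def
      proof (rule degree_diff_le)
        have "Polynomial.degree (Polynomial.monom (a * inverse b) (?n - ?m) * reflect_poly H) \<le> (?n - ?m) + ?m"
          by (rule order_trans[OF degree_mult_le]) (intro add_mono degree_monom_le degree_reflect_poly_le)
        then show "Polynomial.degree (Polynomial.monom (a * inverse b) (?n - ?m) * reflect_poly H) \<le> ?n"
          using le by simp
      qed simp
      ultimately have "Polynomial.degree F' < ?n"
        using False by (metis eq_zero_or_degree_less degree_0 gr0I)
      then show False using F'1 F'2 by (rule IH)
    qed
  qed
  note step = this
  show False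
  proof (cases "Polynomial.degree H \<le> Polynomial.degree F")
    case True
    show False
    proof (rule step[OF True less.prems])
      fix F' assume "Polynomial.degree F' < Polynomial.degree F" "(F', 1) \<in> upoly_rel R" "poly F' x = 0"
      then show False using less.hyps[of F' H x] less.prems by auto
    qed
  next
    case False
    show False
    proof (rule step[of F H "inverse x"])
      fix H' assume "Polynomial.degree H' < Polynomial.degree H" "(H', 1) \<in> upoly_rel R" "poly H' (inverse x) = 0"
      then show False using less.hyps[of F H' x] less.prems by auto
    qed (use False less.prems in auto)
  qed
qed

lemma place: "place R"
proof (intro place.intro ring_rel_axioms place_axioms.intro functional)
  fix x assume x: "x \<notin> Domain R"
  then have "x \<noteq> 0" using zero by blast
  obtain F where F: "(F, 1) \<in> upoly_rel R" "poly F x = 0"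
    using x by (rule relation_of_not_in_Domain)
  have "inverse x \<in> Domain R"
  proof (rule ccontr)
    assume "inverse x \<notin> Domain R"
    then obtain H where "(H, 1) \<in> upoly_rel R" "poly H (inverse x) = 0"
      by (rule relation_of_not_in_Domain)
    then show False using no_opposite_relations[OF \<open>x \<noteq> 0\<close> F] by blast
  qed
  then obtain y where y: "(inverse x, y) \<in> R" by blast
  have "y = 0"
  proof (rule ccontr)
    assume "y \<noteq> 0"
    then have "(x, inverse y) \<in> R" using inverse_rel[OF y] by simp
    with x show False by blast
  qed
  with y show "(inverse x, 0) \<in> R" by simp
qed auto

end

text \<open>Zorn's lemma, starting from the graph of \<open>\<int> \<rightarrow> 'b\<close> on the copy of \<open>\<int>\<close> in a field of characteristic \<open>0\<close>.\<close>
lemma exists_place: "\<exists>R :: ('a::field_char_0 \<times> 'b::alg_closed_field) set. place R"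
proof -
  let ?P = "{R :: ('a \<times> 'b) set. partial_hom R}"
  have "partial_hom {(of_int n :: 'a, of_int n :: 'b) | n. True}" (is "partial_hom ?Z")
  proof
    show "(1, 1) \<in> ?Z" by (auto intro: exI[of _ 1])
    fix a b c d assume "(a, b) \<in> ?Z" "(c, d) \<in> ?Z"
    then obtain m n where "a = of_int m" "b = of_int m" "c = of_int n" "d = of_int n" by blast
    then show "(a - c, b - d) \<in> ?Z" "(a * c, b * d) \<in> ?Z"
      by (auto intro: exI[of _ "m - n"] exI[of _ "m * n"])
  qed auto
  then have "?P \<noteq> {}" by blast
  moreover have "\<Union>C \<in> ?P" if C: "C \<noteq> {}" "subset.chain ?P C" for C
  proof -
    have hom: "partial_hom S" if "S \<in> C" for S using that C(2) unfolding subset.chain_def by blast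
    have pair: "\<exists>S\<in>C. z \<in> S \<and> w \<in> S" if zw: "z \<in> \<Union>C" "w \<in> \<Union>C" for z w
    proof -
      obtain S T where "S \<in> C" "T \<in> C" "z \<in> S" "w \<in> T" using zw by blast
      moreover have "S \<subseteq> T \<or> T \<subseteq> S"
        using C(2) calculation(1,2) unfolding subset.chain_def by blast
      ultimately show ?thesis by blast
    qed
    have "partial_hom (\<Union>C)"
    proof
      obtain S where "S \<in> C" using C(1) by blast
      then show "(1, 1) \<in> \<Union>C"
        using hom[of S] ring_rel.one[of S] unfolding partial_hom_def by blast
    next
      fix a b c d assume "(a, b) \<in> \<Union>C" "(c, d) \<in> \<Union>C"
      then obtain S where S: "S \<in> C" "(a, b) \<in> S" "(c, d) \<in> S" using pair by blast
      then interpret partial_hom S using hom by blast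
      show "(a - c, b - d) \<in> \<Union>C" "(a * c, b * d) \<in> \<Union>C"
        using diff[OF S(2,3)] mult[OF S(2,3)] S(1) by blast+
    next
      fix b assume "(0, b) \<in> \<Union>C"
      then obtain S where "S \<in> C" "(0, b) \<in> S" by blast
      then show "b = 0" using partial_hom.functional hom by blast
    qed
    then show ?thesis by blast
  qed
  ultimately obtain M where M: "M \<in> ?P" "\<forall>S\<in>?P. M \<subseteq> S \<longrightarrow> S = M"
    using subset_Zorn_nonempty[of ?P] by blast
  have "maximal_partial_hom M"
  proof (intro maximal_partial_hom.intro maximal_partial_hom_axioms.intro)
    show "partial_hom M" using M(1) by blast
    show "S = M" if "partial_hom S" "M \<subseteq> S" for S using that M(2) by blast
  qed
  then show ?thesis using maximal_partial_hom.place by blast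
qed

theorem corollary3p4:
  fixes G :: "('g, 'm) monoid_scheme" and p :: nat
  assumes "Factorial_Ring.prime p" and "Group.group G" and "finite (carrier G)" and "weakly_tame p G"
    and "card (UNIV :: 'Fp set) = p"
  shows "essential_dimension TYPE(rat) G \<ge> essential_dimension TYPE('Fp::field) G \<and>
    (CHAR('k::field) = p \<longrightarrow>
     (\<exists>h :: 'Fp alg_closure \<Rightarrow> 'k. h \<in> ring_hom ring_of_type_algebra ring_of_type_algebra) \<longrightarrow>
     essential_dimension TYPE('K::field_char_0) G \<ge> essential_dimension TYPE('k) G)"
proof (intro conjI impI)
  have "CHAR('Fp) dvd p"
    using CHAR_dvd_CARD[where ?'a = 'Fp] assms(5) by simp
  then have "CHAR('Fp) = p"
    using assms(1) CHAR_not_1[where ?'a = 'Fp] by (auto simp: prime_nat_iff)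
  then show "essential_dimension TYPE('Fp) G \<le> essential_dimension TYPE(rat) G"
    using assms(1-4) by (intro place.essential_dimension_specialise[OF place_rat])
next
  assume "CHAR('k) = p" and "\<exists>h :: 'Fp alg_closure \<Rightarrow> 'k. h \<in> ring_hom ring_of_type_algebra ring_of_type_algebra"
  then obtain h :: "'Fp alg_closure \<Rightarrow> 'k" where h: "h \<in> ring_hom ring_of_type_algebra ring_of_type_algebra"
    by blast
  obtain R :: "('K \<times> 'Fp alg_closure) set" where R: "place R"
    using exists_place by blast
  show "essential_dimension TYPE('k) G \<le> essential_dimension TYPE('K) G"
    using assms(1-4) \<open>CHAR('k) = p\<close>
    by (intro place.essential_dimension_specialise[OF place_comp[OF R h]])
qed

end
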